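(* Let $d\ge2$, $k\ge2$, let $U\subseteq\mathbb{R}^d$ be open, let $\pi_1,\dots,\pi_k:\overline U\to\mathbb{R}^{d-1}$ be smooth submersions with associated vector fields $X_1,\dots,X_k$, and let $V_j:=\pi_j(U)$. Let $I_0=(w_1,\dots,w_d)$ be a $d$-tuple of words, $b_0:=\deg I_0$, and assume that $b_0$ is minimal in the sense that $\lambda_{I'}\equiv0$ for every $d$-tuple of words $I'$ with $\deg I'\prec\deg I_0$. Let $\rho:=|\det(X_{w_1},\dots,X_{w_d})|^{\frac1{|b_0|_1-1}}$. Let $F:U\to\mathbb{R}^d$ with $F(U)\subseteq U$ and $G_j:V_j\to\mathbb{R}^{d-1}$, $1\le j\le k$, be smooth maps. Define $\tilde\pi_j:=G_j\circ\pi_j\circ F$, let $\widetilde X_j:=\star(d\tilde\pi_j^1\wedge\cdots\wedge d\tilde\pi_j^{d-1})$, let $\widetilde X_w$ be the iterated brackets built from $\widetilde X_1,\dots,\widetilde X_k$, and let $\tilde\rho:=|\det(\widetilde X_{w_1},\dots,\widetilde X_{w_d})|^{\frac1{|b_0|_1-1}}$. Then on $U$ $$\tilde\rho=\Bigl(\prod_{j=1}^k|(\det DG_j)\circ\pi_j\circ F|^{\mathbf q_j(b_0)}\Bigr)\,|\det DF|\;\rho\circ F.$$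
   Context: Submersion: smooth map with surjective differential at every point. The vector fields are $X_j:=\star(d\pi_j^1\wedge\cdots\wedge d\pi_j^{d-1})$, $1\le j\le k$, where $\star$ is the Hodge star from $(d-1)$-forms to one-forms composed with the identification of one-forms with vectors via the Euclidean metric. For $b_1,b_2\in\mathbb{Z}_0^k$ (nonnegative integer vectors), $b_1\prec b_2$ means $b_1^i\le b_2^i$ for all $i$ with at least one inequality strict. $|b|_1$ is the $\ell^1$ norm. $\mathbf q(b):=\frac{b}{|b|_1-1}$ for $|b|_1>1$, with components $\mathbf q_j(b)$; $0^0=1$. A word is an element of $\mathcal W:=\bigcup_{n\ge1}\{1,\dots,k\}^n$. To each word $w$ is associated a vector field $X_w$ by $X_{(i)}:=X_i$ and $X_{(w,i)}:=[X_w,X_i]$ (Lie bracket); similarly $\widetilde X_w$ from the $\widetilde X_i$. $\deg w\in\mathbb{Z}_0^k$ has $i$-th entry equal to the number of occurrences of $i$ in $w$. For a $d$-tuple of words $I=(w_1,\dots,w_d)$, $\deg I:=\sum_{i=1}^d\deg w_i$ and $\lambda_I:=\det(X_{w_1},\dots,X_{w_d})$. *)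

theory Defs
  imports "HOL-Analysis.Analysis"
begin

section \<open>Smooth maps and submersions\<close>

text \<open>Meant for open \<open>S\<close>; the derivative of order \<open>n\<close> is taken one direction at a time.\<close>

primrec Ck_on :: "nat \<Rightarrow> 'a::real_normed_vector set \<Rightarrow> ('a \<Rightarrow> 'b::real_normed_vector) \<Rightarrow> bool" where
  "Ck_on 0 S f \<longleftrightarrow> continuous_on S f"
| "Ck_on (Suc n) S f \<longleftrightarrow>
     (\<forall>x\<in>S. f differentiable (at x)) \<and> (\<forall>v. Ck_on n S (\<lambda>x. frechet_derivative f (at x) v))"

text \<open>A map on a set that need not be open (such as the closure of an open set) is smooth if it
  is the restriction of a smooth map on an open neighbourhood. For open \<open>S\<close> this is the same as
  being of class \<open>Ck\<close> on \<open>S\<close> for every \<open>k\<close>, see \<open>smooth_on_open_iff\<close> below.\<close>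

definition smooth_extension ::
    "'a::real_normed_vector set \<Rightarrow> ('a \<Rightarrow> 'b::real_normed_vector) \<Rightarrow> ('a \<Rightarrow> 'b) \<Rightarrow> bool" where
  "smooth_extension S f g \<longleftrightarrow>
     (\<exists>W. open W \<and> S \<subseteq> W \<and> (\<forall>n. Ck_on n W g)) \<and> (\<forall>x\<in>S. g x = f x)"

definition smooth_on :: "'a::real_normed_vector set \<Rightarrow> ('a \<Rightarrow> 'b::real_normed_vector) \<Rightarrow> bool" where
  "smooth_on S f \<longleftrightarrow> (\<exists>g. smooth_extension S f g)"

text \<open>If \<open>S\<close> is the closure of an open set, the derivative of \<open>g\<close> at the points of \<open>S\<close>
  does not depend on the choice of the extension \<open>g\<close>, by continuity.\<close>

definition smooth_submersion_on ::
    "'a::real_normed_vector set \<Rightarrow> ('a \<Rightarrow> 'b::real_normed_vector) \<Rightarrow> bool" where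
  "smooth_submersion_on S f \<longleftrightarrow>
     (\<exists>g. smooth_extension S f g \<and> (\<forall>x\<in>S. surj (frechet_derivative g (at x))))"

lemma frechet_derivative_cong_open:
  assumes "open S" "x \<in> S" "\<And>y. y \<in> S \<Longrightarrow> f y = g y"
  shows "frechet_derivative f (at x) = frechet_derivative g (at x)"
proof -
  have "(f has_derivative D) (at x) \<longleftrightarrow> (g has_derivative D) (at x)" for D
    using has_derivative_transform_within_open[of f D x UNIV S g]
      has_derivative_transform_within_open[of g D x UNIV S f] assms by auto
  then show ?thesis
    by (simp add: frechet_derivative_def)
qed

lemma Ck_on_cong_open:
  assumes "open S" "\<And>y. y \<in> S \<Longrightarrow> f y = g y" "Ck_on n S f"
  shows "Ck_on n S g"
  using assms(2,3)
proof (induction n arbitrary: f g)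
  case 0
  then show ?case using continuous_on_cong[of S S f g] by auto
next
  case (Suc n)
  have "g differentiable (at x)" if "x \<in> S" for x
  proof -
    obtain D where "(f has_derivative D) (at x)"
      using Suc.prems(2) \<open>x \<in> S\<close> unfolding Ck_on.simps differentiable_def by blast
    then have "(g has_derivative D) (at x)"
      using has_derivative_transform_within_open[of f D x UNIV S g] Suc.prems(1) that assms(1)
      by auto
    then show ?thesis by (auto simp: differentiable_def)
  qed
  moreover have "Ck_on n S (\<lambda>x. frechet_derivative g (at x) v)" for v
    using Suc.IH[of "\<lambda>x. frechet_derivative f (at x) v" "\<lambda>x. frechet_derivative g (at x) v"]
      Suc.prems frechet_derivative_cong_open[OF assms(1), of _ f g] by auto
  ultimately show ?case by simp
qed

lemma Ck_on_subset: "Ck_on n W f \<Longrightarrow> S \<subseteq> W \<Longrightarrow> Ck_on n S f"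
  by (induction n arbitrary: f) (auto intro: continuous_on_subset)

lemma smooth_on_open_iff:
  assumes "open S"
  shows "smooth_on S f \<longleftrightarrow> (\<forall>n. Ck_on n S f)"
proof
  assume "smooth_on S f"
  then obtain g W where "S \<subseteq> W" "\<And>n. Ck_on n W g" "\<And>x. x \<in> S \<Longrightarrow> g x = f x"
    by (auto simp: smooth_on_def smooth_extension_def)
  then show "\<forall>n. Ck_on n S f"
    using Ck_on_cong_open[OF assms, of g f] Ck_on_subset by blast
next
  assume "\<forall>n. Ck_on n S f"
  then show "smooth_on S f"
    using assms by (auto simp: smooth_on_def smooth_extension_def)
qed

section \<open>The Hodge star from (d-1)-forms to one-forms\<close>

text \<open>The type \<open>'d\<close> indexes the coordinates of the ambient space and \<open>'e\<close>, which is to have one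
  element less, those of the target. Both are linearly ordered; the order of \<open>'d\<close> orients the
  space. An \<open>'e\<close>-form is a function of an \<open>'e\<close>-indexed family of vectors.\<close>

definition wedge :: "('e::finite \<Rightarrow> 'v \<Rightarrow> real) \<Rightarrow> ('e \<Rightarrow> 'v) \<Rightarrow> real" where
  "wedge \<alpha> v = det (\<chi> i j. \<alpha> i (v j))"

text \<open>The increasing enumeration by \<open>'e\<close> of the indices different from \<open>i\<close>.\<close>

definition skip :: "'d::{finite,linorder} \<Rightarrow> 'e::{finite,linorder} \<Rightarrow> 'd" where
  "skip i j = sorted_list_of_set (- {i}) ! card {..<j}"

text \<open>The star of the basis form that omits \<open>dx\<^sup>i\<close> is \<open>dx\<^sup>i\<close> with the sign \<open>(-1)\<^sup>d\<^sup>-\<^sup>i\<close> which makes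
  (omitted form) \<open>\<and>\<close> (its star) the volume form, see \<open>hodge_star_basis\<close>. The coefficient of the
  basis form in \<open>\<omega>\<close> is the value of \<open>\<omega>\<close> on the corresponding basis vectors.\<close>

definition hodge_star ::
    "(('e::{finite,linorder} \<Rightarrow> real ^ 'd::{finite,linorder}) \<Rightarrow> real)
      \<Rightarrow> real ^ 'd::{finite,linorder} \<Rightarrow> real" where
  "hodge_star \<omega> v = (\<Sum>i\<in>UNIV. (- 1) ^ card {i<..} * \<omega> (\<lambda>j. axis (skip i j) 1) * v $ i)"

definition sharp :: "(real ^ 'd \<Rightarrow> real) \<Rightarrow> real ^ 'd" where
  "sharp \<eta> = (\<chi> i. \<eta> (axis i 1))"

definition star_field ::
    "(real ^ 'd::{finite,linorder} \<Rightarrow> real ^ 'e::{finite,linorder})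
      \<Rightarrow> real ^ 'd::{finite,linorder} \<Rightarrow> real ^ 'd::{finite,linorder}" where
  "star_field p x = sharp (hodge_star (wedge (\<lambda>i. frechet_derivative (\<lambda>y. p y $ i) (at x))))"

lemma skip_strict_mono:
  assumes "CARD('d::{finite,linorder}) = CARD('e::{finite,linorder}) + 1"
  shows "strict_mono (skip (i::'d) :: 'e \<Rightarrow> 'd)"
proof
  fix j j' :: 'e
  assume "j < j'"
  then have "card {..<j} < card {..<j'}"
    by (intro psubset_card_mono) auto
  moreover have "card {..<j'} < CARD('e)"
    by (intro psubset_card_mono) auto
  moreover have "length (sorted_list_of_set (- {i})) = CARD('e)"
    using assms by (simp add: Compl_eq_Diff_UNIV card_Diff_singleton)
  ultimately show "skip i j < skip i j'"
    unfolding skip_def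
    using sorted_wrt_nth_less[OF strict_sorted_list_of_set[of "- {i}"]] by metis
qed

lemma range_skip:
  assumes "CARD('d::{finite,linorder}) = CARD('e::{finite,linorder}) + 1"
  shows "range (skip (i::'d) :: 'e \<Rightarrow> 'd) = - {i}"
proof (rule card_subset_eq)
  have len: "length (sorted_list_of_set (- {i})) = CARD('e)"
    using assms by (simp add: Compl_eq_Diff_UNIV card_Diff_singleton)
  show "range (skip i :: 'e \<Rightarrow> 'd) \<subseteq> - {i}"
  proof
    fix a assume "a \<in> range (skip i :: 'e \<Rightarrow> 'd)"
    then obtain j :: 'e where a: "a = skip i j" by blast
    have "card {..<j} < CARD('e)"
      by (intro psubset_card_mono) auto
    then have "a \<in> set (sorted_list_of_set (- {i}))"
      unfolding a skip_def using len by (metis nth_mem)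
    then show "a \<in> - {i}" by simp
  qed
  show "card (range (skip i :: 'e \<Rightarrow> 'd)) = card (- {i})"
    using assms card_image[OF strict_mono_imp_inj_on[OF skip_strict_mono[OF assms, of i]]]
    by (simp add: Compl_eq_Diff_UNIV card_Diff_singleton)
qed simp

lemma hodge_star_basis:
  fixes i :: "'d::{finite,linorder}"
  assumes "CARD('d) = CARD('e::{finite,linorder}) + 1"
  shows "hodge_star (wedge (\<lambda>(a::'e) (v::real ^ 'd::{finite,linorder}). v $ skip i a)) v =
    (- 1) ^ card {i<..} * v $ i"
proof -
  have eq: "wedge (\<lambda>(a::'e) (v::real ^ 'd::{finite,linorder}). v $ skip i a)
      (\<lambda>j. axis (skip i' j) 1) = (if i' = i then 1 else 0)" for i'
  proof (cases "i' = i")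
    case True
    have "inj (skip i :: 'e \<Rightarrow> 'd)"
      using skip_strict_mono[OF assms] strict_mono_imp_inj_on by blast
    then have "(\<chi> a j. axis (skip i j) (1::real) $ skip i a
        :: real ^ 'e::{finite,linorder} ^ 'e::{finite,linorder}) = mat 1"
      by (auto simp: vec_eq_iff axis_def mat_def inj_eq)
    then show ?thesis using True by (simp add: wedge_def)
  next
    case False
    then obtain a :: 'e where a: "skip i a = i'"
      using range_skip[OF assms, of i] by (metis ComplI imageE singletonD)
    have "skip i' j \<noteq> i'" for j :: 'e
      using range_skip[OF assms, of i'] by (metis ComplD rangeI singletonI)
    then have "row a (\<chi> a j. axis (skip i' j) (1::real) $ skip i a
        :: real ^ 'e::{finite,linorder} ^ 'e::{finite,linorder}) = 0"
      by (simp add: row_def vec_eq_iff axis_def a eq_commute[of i'])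
    then show ?thesis using False
      by (simp add: wedge_def det_zero_row)
  qed
  show ?thesis
    by (simp add: hodge_star_def eq if_distrib[of "\<lambda>c. _ * c * _"] cong: if_cong)
qed

section \<open>Words and iterated Lie brackets\<close>

definition lie_bracket ::
    "('a::real_normed_vector \<Rightarrow> 'a) \<Rightarrow> ('a \<Rightarrow> 'a) \<Rightarrow> 'a \<Rightarrow> 'a" where
  "lie_bracket Y Z x = frechet_derivative Z (at x) (Y x) - frechet_derivative Y (at x) (Z x)"

definition words :: "nat \<Rightarrow> nat list set" where
  "words k = {w. w \<noteq> [] \<and> set w \<subseteq> {1..k}}"

definition word_field :: "(nat \<Rightarrow> 'a::real_normed_vector \<Rightarrow> 'a) \<Rightarrow> nat list \<Rightarrow> 'a \<Rightarrow> 'a" where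
  "word_field X w = foldl (\<lambda>Y i. lie_bracket Y (X i)) (X (hd w)) (tl w)"

lemma word_field_single: "word_field X [i] = X i"
  by (simp add: word_field_def)

lemma word_field_snoc: "w \<noteq> [] \<Longrightarrow> word_field X (w @ [i]) = lie_bracket (word_field X w) (X i)"
  by (simp add: word_field_def)

text \<open>A \<open>d\<close>-tuple of words is a function on the index type \<open>'d\<close>. Degrees are functions on \<open>nat\<close>, of
  which only the values on \<open>{1..k}\<close> are used.\<close>

definition deg :: "('d::finite \<Rightarrow> nat list) \<Rightarrow> nat \<Rightarrow> nat" where
  "deg I i = (\<Sum>a\<in>UNIV. count_list (I a) i)"

definition prec :: "nat \<Rightarrow> (nat \<Rightarrow> nat) \<Rightarrow> (nat \<Rightarrow> nat) \<Rightarrow> bool" where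
  "prec k b1 b2 \<longleftrightarrow> (\<forall>i\<in>{1..k}. b1 i \<le> b2 i) \<and> (\<exists>i\<in>{1..k}. b1 i < b2 i)"

definition norm1 :: "nat \<Rightarrow> (nat \<Rightarrow> nat) \<Rightarrow> nat" where
  "norm1 k b = (\<Sum>i=1..k. b i)"

definition qexp :: "nat \<Rightarrow> (nat \<Rightarrow> nat) \<Rightarrow> nat \<Rightarrow> real" where
  "qexp k b j = real (b j) / (real (norm1 k b) - 1)"

text \<open>Column \<open>c\<close> of the matrix is the field of the word \<open>I c\<close>.\<close>

definition lambda ::
    "(nat \<Rightarrow> real ^ 'd \<Rightarrow> real ^ 'd) \<Rightarrow> ('d::finite \<Rightarrow> nat list) \<Rightarrow> real ^ 'd \<Rightarrow> real" where
  "lambda X I x = det (\<chi> r c. word_field X (I c) x $ r)"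

text \<open>The real power with \<open>0\<^sup>0 = 1\<close>, whereas \<open>0 powr 0 = 0\<close>.\<close>

definition rpow :: "real \<Rightarrow> real \<Rightarrow> real" where
  "rpow a s = (if s = 0 then 1 else a powr s)"

definition rho ::
    "nat \<Rightarrow> (nat \<Rightarrow> real ^ 'd \<Rightarrow> real ^ 'd) \<Rightarrow> ('d::finite \<Rightarrow> nat list) \<Rightarrow> real ^ 'd \<Rightarrow> real" where
  "rho k X I x = rpow \<bar>lambda X I x\<bar> (1 / (real (norm1 k (deg I)) - 1))"

end

theory Submission
  imports Defs
begin

text \<open>Write \<open>\<delta> = det DF\<close> and \<open>g\<^sub>j = (det DG\<^sub>j) \<circ> \<pi>\<^sub>j \<circ> F\<close>. The star field of \<open>p\<close> is
  the generalized cross product of the rows of \<open>Dp\<close>, so by multiplicativity of the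
  determinant it transforms under \<open>p \<mapsto> G \<circ> p \<circ> F\<close> as
  \<open>DF (X'\<^sub>j) = f\<^sub>j (X\<^sub>j \<circ> F)\<close> with \<open>f\<^sub>j = g\<^sub>j \<delta>\<close>
  (\<open>star_vec_pullback\<close>, \<open>star_vec_mult_left\<close>). Where \<open>F\<close> is a local diffeomorphism this says that
  \<open>X'\<^sub>j\<close> is \<open>f\<^sub>j\<close> times the pullback of \<open>X\<^sub>j\<close>, but the relation itself does not involve the
  inverse of \<open>DF\<close>.

  Taking brackets of such relations and applying the Leibniz rule, one gets that
  \<open>DF (X'\<^sub>w) = (\<Prod>i\<in>w. f\<^sub>i) (X\<^sub>w \<circ> F)\<close> up to smooth combinations of fields \<open>X\<^sub>v \<circ> F\<close> with
  \<open>deg v \<prec> deg w\<close>: each derivative that falls on a coefficient costs a letter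
  (\<open>pushforward_word_field\<close>). The symmetry of the second derivative of \<open>F\<close> enters here, through
  the naturality of the bracket (\<open>pushforward_lie_bracket\<close>).

  Insert this into the determinant and expand. Every term that contains a lower word is a multiple
  of some \<open>\<lambda>\<^sub>I\<close> with \<open>deg I \<prec> b\<^sub>0\<close> at \<open>F(x)\<close> and vanishes by minimality. This leaves
  \<open>\<delta> \<lambda>' = (\<Prod>j. f\<^sub>j ^ b\<^sub>0\<^sup>j) (\<lambda> \<circ> F)\<close> (\<open>det_pushforward_word_fields\<close>), that is,
  \<open>\<lambda>' = (\<Prod>j. g\<^sub>j ^ b\<^sub>0\<^sup>j) \<delta> ^ (|b\<^sub>0| - 1) (\<lambda> \<circ> F)\<close> wherever \<open>\<delta> \<noteq> 0\<close>.

  Both sides are continuous, so the identity extends to the closure of \<open>{\<delta> \<noteq> 0}\<close>. At the other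
  points \<open>\<delta>\<close> vanishes identically nearby and \<open>\<lambda>' = 0\<close> has to be shown. There all \<open>X'\<^sub>w\<close> lie in the
  kernel of \<open>DF\<close>, since the fields annihilated by \<open>DF\<close> on an open set are closed under brackets.
  If \<open>DF(x) \<noteq> 0\<close>, the kernel is a proper subspace; if \<open>DF(x) = 0\<close>, all \<open>X'\<^sub>j\<close> and therefore all
  \<open>X'\<^sub>w\<close> vanish at \<open>x\<close> (\<open>lambda_zero_of_degenerate\<close>). The theorem is the power
  \<open>1 / (|b\<^sub>0| - 1)\<close> of the resulting identity \<open>lambda_pullback\<close>.\<close>

section \<open>Determinants\<close>

lemma linear_det_row: "linear (\<lambda>z. det (\<chi> a. if a = b then z else s a :: real ^ 'n ^ 'n))"
proof (rule linearI)
  fix y z :: "real ^ 'n" and c :: real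
  show "det (\<chi> a. if a = b then y + z else s a :: real ^ 'n ^ 'n) =
      det (\<chi> a. if a = b then y else s a) + det (\<chi> a. if a = b then z else s a)"
    by (rule det_row_add)
  show "det (\<chi> a. if a = b then c *\<^sub>R z else s a :: real ^ 'n ^ 'n) =
      c *\<^sub>R det (\<chi> a. if a = b then z else s a)"
    using det_row_mul[of b c "\<lambda>_. z" s] unfolding scalar_mult_eq_scaleR real_scaleR_def .
qed

text \<open>The determinant is linear in each row, so one row after the other can be moved from \<open>V a\<close> to its
  span.\<close>

lemma det_zero_span:
  fixes u :: "'n::finite \<Rightarrow> real ^ 'n"
  assumes zero: "\<And>s. (\<And>a. s a \<in> V a) \<Longrightarrow> det (\<chi> a. s a) = 0"
    and u: "\<And>a. u a \<in> span (V a)"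
  shows "det (\<chi> a. u a) = 0"
proof -
  have "det (\<chi> a. s a) = 0"
    if "\<And>a. a \<in> T \<Longrightarrow> s a \<in> span (V a)" "\<And>a. a \<notin> T \<Longrightarrow> s a \<in> V a" "finite T" for s T
    using that(3,1,2)
  proof (induction T arbitrary: s rule: finite_induct)
    case (insert b T)
    have "det (\<chi> a. if a = b then z else s a) = 0" if "z \<in> V b" for z
    proof (rule insert.IH)
      show "(if a = b then z else s a) \<in> span (V a)" if "a \<in> T" for a
        using insert.prems(1)[of a] insert.hyps(2) that by auto
      show "(if a = b then z else s a) \<in> V a" if "a \<notin> T" for a
        using insert.prems(2)[of a] \<open>z \<in> V b\<close> that by auto
    qed
    then have "det (\<chi> a. if a = b then s b else s a) = 0"
      by (rule linear_eq_0_on_span[OF linear_det_row _ insert.prems(1)]) simp_all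
    moreover have "(\<chi> a. if a = b then s b else s a) = (\<chi> a. s a)" by (simp add: vec_eq_iff)
    ultimately show ?case by (simp only:)
  next
    case empty
    then show ?case by (intro zero) simp
  qed
  note * = this
  show ?thesis by (rule *[of UNIV u]) (simp_all add: u)
qed

text \<open>Here \<open>V\<close> collects the vectors of full or lower order and \<open>W\<close> those of lower order: the lower
  order parts of the rows can be dropped, one row at a time, when a single row of lower order
  makes the determinant vanish.\<close>

lemma det_add_negligible:
  fixes t l :: "'n::finite \<Rightarrow> real ^ 'n"
  assumes zero: "\<And>b s. (\<And>a. s a \<in> V a) \<Longrightarrow> s b \<in> W b \<Longrightarrow> det (\<chi> a. s a) = 0"
    and sub: "\<And>a. W a \<subseteq> V a"
    and t: "\<And>a. t a \<in> span (V a)" and l: "\<And>a. l a \<in> span (W a)"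
  shows "det (\<chi> a. t a + l a) = det (\<chi> a. t a)"
proof -
  have "det (\<chi> a. if a \<in> T then t a + l a else t a) = det (\<chi> a. t a)" if "finite T" for T
    using that
  proof (induction T rule: finite_induct)
    case (insert b T)
    let ?s = "\<lambda>a. if a \<in> T then t a + l a else t a"
    let ?R = "\<lambda>z. \<chi> a. if a = b then z else ?s a"
    have eq: "(\<chi> a. if a \<in> insert b T then t a + l a else t a) = ?R (t b + l b)"
      "(\<chi> a. ?s a) = ?R (t b)"
      using insert.hyps by (auto simp: vec_eq_iff)
    have "det (?R (l b)) = 0"
    proof (rule det_zero_span[where V = "V(b := W b)"])
      fix s assume s: "\<And>a. s a \<in> (V(b := W b)) a"
      have "s b \<in> W b" using s[of b] by simp
      moreover have "s a \<in> V a" for a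
        using s[of a] subsetD[OF sub, of "s b" b] by (cases "a = b") simp_all
      ultimately show "det (\<chi> a. s a) = 0" by (rule zero[rotated])
    next
      fix a
      have "l a \<in> span (V a)" using span_mono[OF sub] l by (rule subsetD)
      then show "(if a = b then l b else ?s a) \<in> span ((V(b := W b)) a)"
        using l t by (simp add: span_add)
    qed
    then show ?case
      using insert.IH linear_add[OF linear_det_row[of b ?s], of "t b" "l b"]
      unfolding eq by linarith
  qed simp
  from this[of UNIV] show ?thesis by simp
qed

lemma image_rows:
  fixes B :: "real ^ 'n ^ 'n" and u :: "'n::finite \<Rightarrow> real ^ 'n"
  shows "(\<chi> a. B *v u a) = (\<chi> a. u a) ** Finite_Cartesian_Product.transpose B"
  by (simp add: vec_eq_iff matrix_vector_mult_def matrix_matrix_mult_def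
      Finite_Cartesian_Product.transpose_def mult.commute)

lemma det_image_rows:
  fixes B :: "real ^ 'n ^ 'n" and u :: "'n::finite \<Rightarrow> real ^ 'n"
  shows "det (\<chi> a. B *v u a) = det B * det (\<chi> a. u a)"
  by (simp add: image_rows det_mul det_transpose mult.commute)

text \<open>If the rows were a basis, the matrix \<open>B\<close> would vanish on the whole space.\<close>

lemma det_zero_kernel_rows:
  fixes B :: "real ^ 'n ^ 'n" and u :: "'n::finite \<Rightarrow> real ^ 'n"
  assumes "B \<noteq> 0" "\<And>a. B *v u a = 0"
  shows "det (\<chi> a. u a) = 0"
proof (rule ccontr)
  assume "det (\<chi> a. u a) \<noteq> 0"
  then obtain U' where U': "U' ** (\<chi> a. u a) = mat 1"
    unfolding invertible_det_nz[symmetric] invertible_def by blast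
  have "(\<chi> a. u a) ** Finite_Cartesian_Product.transpose B = 0"
    using assms(2) by (simp add: image_rows[symmetric] vec_eq_iff)
  moreover have "U' ** (0 :: real ^ 'n ^ 'n) = 0"
    by (simp add: matrix_matrix_mult_def vec_eq_iff)
  ultimately have "(U' ** (\<chi> a. u a)) ** Finite_Cartesian_Product.transpose B = 0"
    by (simp only: matrix_mul_assoc[symmetric])
  then have "Finite_Cartesian_Product.transpose B = 0" by (simp add: U')
  then have "B = 0" by (simp add: vec_eq_iff Finite_Cartesian_Product.transpose_def)
  then show False using assms(1) by contradiction
qed

section \<open>The star of the rows of a matrix\<close>

text \<open>At the smallest point of disagreement, the smaller of the two values could not be attained by
  the other function.\<close>

lemma strict_mono_eqI:
  fixes f g :: "'a::{finite,linorder} \<Rightarrow> 'b::linorder"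
  assumes "strict_mono f" "strict_mono g" "range f = range g"
  shows "f = g"
proof (rule ccontr)
  assume "f \<noteq> g"
  then have ne: "{a. f a \<noteq> g a} \<noteq> {}" by auto
  define a where "a = Min {a. f a \<noteq> g a}"
  have a: "f a \<noteq> g a" using Min_in[OF _ ne] by (simp add: a_def)
  have below: "f b = g b" if "b < a" for b
    using that Min_le[of "{a. f a \<noteq> g a}" b] leD unfolding a_def by fastforce
  \<comment> \<open>Stated for arbitrary \<open>f\<close> and \<open>g\<close>, since it is applied with both orders of the two.\<close>
  have *: "\<not> f a < g a" if fg: "strict_mono f" "strict_mono g" "range f = range g"
    "\<And>b. b < a \<Longrightarrow> f b = g b" for f g :: "'a \<Rightarrow> 'b"
  proof
    assume less: "f a < g a"
    obtain b where b: "f a = g b" using fg(3) by (metis rangeE rangeI)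
    have "b < a" using less fg(2) b by (simp add: strict_mono_less)
    then have "f b = f a" using fg(4) b by simp
    then show False using fg(1) \<open>b < a\<close> by (simp add: strict_mono_eq)
  qed
  show False
    using *[of f g] *[of g f] assms below a by fastforce
qed

text \<open>A permutation of \<open>A\<close> is a product of transpositions, and these are carried to transpositions.\<close>

lemma sign_map_permutation:
  assumes "finite A" "inj_on f A" "p permutes A"
  shows "sign (map_permutation A f p) = sign p"
  using assms(3,1)
proof (induction rule: permutes_induct)
  case id
  then show ?case by (simp add: map_permutation_ident' map_permutation_id' assms)
next
  case (swap a b p)
  have "map_permutation A f (Transposition.transpose a b \<circ> p) =
      Transposition.transpose (f a) (f b) \<circ> map_permutation A f p"
    using swap assms by (simp add: map_permutation_compose' map_permutation_transpose)
  moreover have "map_permutation A f p permutes f ` A"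
    using swap assms by (intro map_permutation_permutes) (auto simp: bij_betw_def)
  then have "permutation (map_permutation A f p)" "permutation p"
    using swap assms(1) unfolding permutation_permutes by blast+
  moreover have "f a = f b \<longleftrightarrow> a = b"
    using swap assms by (auto simp: inj_on_def)
  ultimately show ?case
    using swap by (simp add: sign_compose permutation_swap_id sign_swap_id del: o_apply)
qed

text \<open>The Laplace expansion along a row that is a unit vector. The injection \<open>s\<close> identifies the
  remaining indices with those of the minor; in the Leibniz formula only the permutations that fix
  \<open>m\<close> contribute, and they correspond to the permutations of the minor.\<close>

lemma det_bordered:
  fixes M :: "'a::comm_ring_1 ^ 'd ^ 'd" and s :: "'e::finite \<Rightarrow> 'd"
  assumes "inj s" "range s = - {m}" "M $ m = axis m 1"
  shows "det M = det (\<chi> a b. M $ s a $ s b :: 'a ^ 'e ^ 'e)"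
proof -
  let ?t = "\<lambda>p. of_int (sign p) * (\<Prod>i\<in>UNIV. M $ i $ p i)"
  have sub: "{p. p permutes - {m}} \<subseteq> {p. p permutes UNIV}"
    by (auto intro: permutes_subset)
  have zero: "?t p = 0" if "p permutes UNIV" "\<not> p permutes - {m}" for p
  proof -
    have "p m \<noteq> m"
      using that permutes_superset[of p UNIV "- {m}"] by auto
    then have "M $ m $ p m = 0" using assms(3) by (simp add: axis_def)
    then show ?thesis by (metis UNIV_I finite mult_zero_right prod_zero)
  qed
  have "det M = (\<Sum>p | p permutes - {m}. ?t p)"
    unfolding det_def
    by (rule sum.mono_neutral_right) (use sub zero in auto)
  also have "\<dots> = (\<Sum>q | q permutes (UNIV :: 'e set). ?t (map_permutation UNIV s q))"
  proof (rule sum.reindex_bij_betw[symmetric])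
    have "bij_betw s UNIV (- {m})" using assms by (auto simp: bij_betw_def)
    from bij_betw_permutations[OF this]
    show "bij_betw (map_permutation UNIV s) {q. q permutes UNIV} {p. p permutes - {m}}"
      using assms(2) by (simp add: map_permutation_def[abs_def] restrict_id_def[abs_def] o_def)
  qed
  also have "\<dots> = det (\<chi> a b. M $ s a $ s b :: 'a ^ 'e ^ 'e)"
    unfolding det_def
  proof (rule sum.cong)
    fix q :: "'e \<Rightarrow> 'e"
    assume "q \<in> {q. q permutes UNIV}"
    then have q: "q permutes UNIV" by simp
    let ?p = "map_permutation UNIV s q"
    have UN: "UNIV = insert m (range s)" using assms(2) by auto
    have "?p m = m" by (simp add: map_permutation_def restrict_id_def assms(2))
    then have "(\<Prod>i\<in>UNIV. M $ i $ ?p i) = (\<Prod>i\<in>range s. M $ i $ ?p i)"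
      unfolding UN by (subst prod.insert) (auto simp: assms)
    also have "\<dots> = (\<Prod>a\<in>UNIV. M $ s a $ s (q a))"
      using assms(1) by (simp add: prod.reindex map_permutation_apply)
    finally show "?t ?p = of_int (sign q) * (\<Prod>i\<in>UNIV. (\<chi> a b. M $ s a $ s b) $ i $ q i)"
      using q assms(1) by (simp add: sign_map_permutation)
  qed simp
  finally show ?thesis .
qed

text \<open>The column permutation in the Laplace expansion: it moves the last index to \<open>i\<close> and keeps the
  order of the others. The type argument names the index type of the minor, which occurs
  only inside the definition.\<close>

definition cycle_to_max :: "'e::{finite,linorder} itself \<Rightarrow> 'd::{finite,linorder} \<Rightarrow> 'd \<Rightarrow> 'd" where
  "cycle_to_max _ i y = (if y = Max UNIV then i else skip i (inv (skip (Max UNIV) :: 'e \<Rightarrow> 'd) y))"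

context
  assumes dim: "CARD('d::{finite,linorder}) = CARD('e::{finite,linorder}) + 1"
begin

lemma inj_skip: "inj (skip (i::'d) :: 'e \<Rightarrow> 'd)"
  using skip_strict_mono[OF dim] strict_mono_imp_inj_on by blast

lemma skip_neq: "skip (i::'d) (a::'e) \<noteq> i"
  using range_skip[OF dim, of i] by (metis ComplD rangeI singletonI)

lemma cycle_to_max_max: "cycle_to_max TYPE('e) (i::'d) (Max UNIV) = i"
  by (simp add: cycle_to_max_def)

lemma cycle_to_max_skip: "cycle_to_max TYPE('e) (i::'d) (skip (Max UNIV) (a::'e)) = skip i a"
  using inj_skip skip_neq by (simp add: cycle_to_max_def inv_f_f)

lemma max_or_skip:
  obtains "y = Max (UNIV :: 'd set)" | a :: 'e where "y = skip (Max UNIV) a"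
  using range_skip[OF dim, of "Max UNIV"] by (metis ComplI rangeE singletonD)

lemma cycle_to_max_permutes: "cycle_to_max TYPE('e) (i::'d) permutes UNIV"
proof -
  have "surj (cycle_to_max TYPE('e) i)"
    unfolding surj_def
  proof
    fix y :: 'd
    show "\<exists>x. y = cycle_to_max TYPE('e) i x"
    proof (cases "y = i")
      case False
      then obtain a :: 'e where "y = skip i a"
        using range_skip[OF dim, of i] by (metis ComplI rangeE singletonD)
      then show ?thesis using cycle_to_max_skip[of i a] by metis
    qed (use cycle_to_max_max[of i] in metis)
  qed
  then show ?thesis
    by (intro bij_imp_permutes) (auto simp: bij_betw_def finite_UNIV_surj_inj)
qed

text \<open>Swapping the neighbours \<open>i\<close> and \<open>i'\<close> preserves the order of the other indices, and an increasing
  enumeration is determined by its range.\<close>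

lemma skip_transpose:
  fixes i i' :: 'd
  assumes "i < i'" and between: "\<And>y. i < y \<Longrightarrow> i' \<le> y"
  shows "skip i a = Transposition.transpose i i' (skip i' (a::'e))"
proof -
  have "skip i = (\<lambda>a. Transposition.transpose i i' (skip i' (a::'e)))"
  proof (rule strict_mono_eqI[OF skip_strict_mono[OF dim]])
    show "strict_mono (\<lambda>a. Transposition.transpose i i' (skip i' (a::'e)))"
    proof
      fix a b :: 'e
      assume "a < b"
      then have "skip i' a < skip i' b"
        by (rule strict_monoD[OF skip_strict_mono[OF dim]])
      then show "Transposition.transpose i i' (skip i' a) < Transposition.transpose i i' (skip i' b)"
        using skip_neq[of i' a] skip_neq[of i' b] assms
        by (auto simp: Transposition.transpose_def order_less_le)
    qed
    show "range (skip i :: 'e \<Rightarrow> 'd) = range (\<lambda>a. Transposition.transpose i i' (skip i' (a::'e)))"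
      using range_skip[OF dim, of i] range_skip[OF dim, of i'] assms(1)
      by (simp add: image_image[symmetric] bij_image_Compl_eq)
  qed
  then show ?thesis by (rule fun_cong)
qed

text \<open>Passing from \<open>i\<close> to its successor removes one transposition, until \<open>i\<close> is the maximum and the
  permutation is the identity.\<close>

lemma sign_cycle_to_max: "sign (cycle_to_max TYPE('e) (i::'d)) = (- 1) ^ card {i<..}"
proof (induction "card {i<..}" arbitrary: i)
  case 0
  then have "{i<..} = {}" by simp
  then have i: "i = Max UNIV"
    by (intro Max_eqI[symmetric]) (auto simp: not_less[symmetric])
  have "cycle_to_max TYPE('e) i y = y" for y
    unfolding i by (cases y rule: max_or_skip) (auto simp: cycle_to_max_max cycle_to_max_skip)
  then have "cycle_to_max TYPE('e) i = id" by auto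
  then show ?case by (simp only: 0[symmetric] sign_id power_0)
next
  case (Suc n)
  then have "card {i<..} \<noteq> 0" by linarith
  then have ne: "{i<..} \<noteq> {}" by force
  define i' where "i' = Min {i<..}"
  have i': "i < i'" "\<And>y. i < y \<Longrightarrow> i' \<le> y"
    using Min_in[OF _ ne] by (auto simp: i'_def)
  have "{i<..} = insert i' {i'<..}" using i' by force
  then have card: "card {i<..} = Suc (card {i'<..})" by simp
  have IH: "sign (cycle_to_max TYPE('e) i') = (- 1) ^ card {i'<..}"
    using Suc(2) card by (intro Suc(1)) linarith
  have "cycle_to_max TYPE('e) i y = (Transposition.transpose i i' \<circ> cycle_to_max TYPE('e) i') y" for y
    by (cases y rule: max_or_skip)
      (auto simp: cycle_to_max_max cycle_to_max_skip skip_transpose[OF i'])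
  then have "cycle_to_max TYPE('e) i = Transposition.transpose i i' \<circ> cycle_to_max TYPE('e) i'"
    by auto
  moreover have "permutation (cycle_to_max TYPE('e) i')"
    unfolding permutation_permutes using cycle_to_max_permutes by (intro exI conjI) (rule finite)
  ultimately show ?case
    using IH i'(1) unfolding card by (simp add: sign_compose permutation_swap_id sign_swap_id)
qed

end

text \<open>The generalized cross product of the rows of \<open>P\<close>: it is the star field of a map at a point where
  \<open>P\<close> is the Jacobian.\<close>

definition star_vec :: "real ^ 'd::{finite,linorder} ^ 'e::{finite,linorder} \<Rightarrow> real ^ 'd::{finite,linorder}" where
  "star_vec P = (\<chi> i. (- 1) ^ card {i<..} * det (\<chi> a b. P $ a $ skip i b))"

definition append_row ::
    "real ^ 'd::{finite,linorder} ^ 'e::{finite,linorder} \<Rightarrow> real ^ 'd::{finite,linorder} \<Rightarrow> real ^ 'd::{finite,linorder} ^ 'd::{finite,linorder}" where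
  "append_row P v = (\<chi> r. if r = Max UNIV then v else P $ inv (skip (Max UNIV)) r)"

lemma det_append_row_axis:
  fixes P :: "real ^ 'd::{finite,linorder} ^ 'e::{finite,linorder}"
  assumes dim: "CARD('d) = CARD('e) + 1"
  shows "det (append_row P (axis i 1)) = star_vec P $ i"
proof -
  let ?c = "cycle_to_max TYPE('e) i" and ?M = "append_row P (axis i 1)"
  let ?m = "Max UNIV :: 'd"
  let ?N = "(\<chi> r c. ?M $ r $ ?c c) :: real ^ 'd::{finite,linorder} ^ 'd::{finite,linorder}"
  have row: "?N $ ?m = axis ?m 1"
  proof -
    have "?c c = i \<longleftrightarrow> c = ?m" for c
      using permutes_inj[OF cycle_to_max_permutes[OF dim, of i]] cycle_to_max_max[OF dim, of i]
      by (metis injD)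
    then show ?thesis
      by (auto simp: append_row_def vec_eq_iff axis_def)
  qed
  have "det ?N = det (\<chi> a b. ?N $ skip ?m a $ skip ?m b :: real ^ 'e::{finite,linorder} ^ 'e::{finite,linorder})"
    by (rule det_bordered[OF inj_skip[OF dim] range_skip[OF dim] row])
  also have "(\<chi> a b. ?N $ skip ?m a $ skip ?m b) =
      (\<chi> a b. P $ a $ skip i b :: real ^ 'e::{finite,linorder} ^ 'e::{finite,linorder})"
    by (simp add: append_row_def skip_neq[OF dim] inv_f_f[OF inj_skip[OF dim]]
        cycle_to_max_skip[OF dim] vec_eq_iff)
  finally have N: "det ?N = det (\<chi> a b. P $ a $ skip i b)" .
  have "det ?N = of_int (sign ?c) * det ?M"
    by (rule det_permute_columns[OF cycle_to_max_permutes[OF dim]])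
  then have "det ?M = of_int (sign ?c) * det ?N"
    by (cases ?c rule: sign_cases) simp_all
  then show ?thesis by (simp add: N star_vec_def sign_cycle_to_max[OF dim])
qed

text \<open>The property that characterizes the cross product, from which its transformation law is read off.\<close>

lemma det_append_row:
  fixes P :: "real ^ 'd::{finite,linorder} ^ 'e::{finite,linorder}"
  assumes dim: "CARD('d) = CARD('e) + 1"
  shows "det (append_row P v) = v \<bullet> star_vec P"
proof -
  have lin: "linear (\<lambda>v. det (append_row P v))"
    unfolding append_row_def by (rule linear_det_row)
  have "det (append_row P v) = (\<Sum>i\<in>UNIV. v $ i * det (append_row P (axis i 1)))"
    using linear_sum[OF lin, of "\<lambda>i. v $ i *\<^sub>R axis i 1" UNIV]
    unfolding basis_expansion[of v, unfolded scalar_mult_eq_scaleR] linear_scale[OF lin]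
    by simp
  then show ?thesis
    by (simp add: det_append_row_axis[OF dim] inner_vec_def)
qed

text \<open>Pairing with \<open>w\<close> turns this into the multiplicativity of the determinant of \<open>P\<close> with the row \<open>w\<close>
  appended. Unlike the formula with the inverse of \<open>B\<close>, it makes sense for singular \<open>B\<close>.\<close>

lemma star_vec_pullback:
  fixes P :: "real ^ 'd::{finite,linorder} ^ 'e::{finite,linorder}"
    and B :: "real ^ 'd::{finite,linorder} ^ 'd::{finite,linorder}"
  assumes dim: "CARD('d) = CARD('e) + 1"
  shows "B *v star_vec (P ** B) = det B *\<^sub>R star_vec P"
proof (rule vector_eq_ldot[THEN iffD1, rule_format])
  fix w :: "real ^ 'd::{finite,linorder}"
  have "append_row (P ** B) (w v* B) = append_row P w ** B"
    by (simp add: append_row_def vec_eq_iff matrix_matrix_mult_def vector_matrix_mult_def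
        mult.commute)
  then have "det (append_row P w) * det B = (w v* B) \<bullet> star_vec (P ** B)"
    using det_append_row[OF dim, of "P ** B" "w v* B"] by (simp add: det_mul)
  then show "w \<bullet> (B *v star_vec (P ** B)) = w \<bullet> (det B *\<^sub>R star_vec P)"
    by (simp add: det_append_row[OF dim] dot_lmul_matrix mult.commute)
qed

lemma star_vec_mult_left:
  fixes P :: "real ^ 'd::{finite,linorder} ^ 'e::{finite,linorder}"
    and A :: "real ^ 'e::{finite,linorder} ^ 'e::{finite,linorder}"
  shows "star_vec (A ** P) = det A *\<^sub>R star_vec P"
proof -
  have "(\<chi> a b. (A ** P) $ a $ skip i b) =
      A ** (\<chi> a b. P $ a $ skip i b :: real ^ 'e::{finite,linorder} ^ 'e::{finite,linorder})" for i
    by (simp add: matrix_matrix_mult_def vec_eq_iff)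
  then have "star_vec (A ** P) $ i = (det A *\<^sub>R star_vec P) $ i" for i
    by (simp add: star_vec_def det_mul)
  then show ?thesis unfolding vec_eq_iff by blast
qed

lemma star_vec_zero: "star_vec (0 :: real ^ 'd::{finite,linorder} ^ 'e::{finite,linorder}) = 0"
proof -
  have "det (\<chi> a b. 0 :: real ^ 'e::{finite,linorder} ^ 'e::{finite,linorder}) = 0"
    by (rule det_zero_row(1)) (simp add: row_def vec_eq_iff)
  then show ?thesis by (simp add: star_vec_def vec_eq_iff zero_vec_def)
qed

section \<open>Calculus of maps of class \<open>Ck\<close>\<close>

lemma Ck_on_differentiable: "Ck_on (Suc n) S f \<Longrightarrow> x \<in> S \<Longrightarrow> f differentiable (at x)"
  by simp

lemma Ck_on_has_derivative:
  "Ck_on (Suc n) S f \<Longrightarrow> x \<in> S \<Longrightarrow> (f has_derivative frechet_derivative f (at x)) (at x)"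
  by (simp add: frechet_derivative_works[symmetric])

lemma Ck_on_SucD: "Ck_on (Suc n) S f \<Longrightarrow> Ck_on n S f"
proof (induction n arbitrary: f)
  case 0
  then show ?case
    by (auto intro!: continuous_at_imp_continuous_on differentiable_imp_continuous_within)
qed auto

text \<open>Spares the use of \<open>frechet_derivative\<close> when a derivative is known explicitly.\<close>

lemma Ck_on_SucI:
  assumes "open S" "\<And>x. x \<in> S \<Longrightarrow> (f has_derivative f' x) (at x)"
    "\<And>v. Ck_on n S (\<lambda>x. f' x v)"
  shows "Ck_on (Suc n) S f"
proof -
  have "Ck_on n S (\<lambda>x. frechet_derivative f (at x) v)" for v
    by (rule Ck_on_cong_open[OF assms(1) _ assms(3)[of v]])
      (simp add: frechet_derivative_at[OF assms(2), symmetric])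
  then show ?thesis using assms(2) by (auto simp: differentiable_def)
qed

lemma Ck_on_const: "open S \<Longrightarrow> Ck_on n S (\<lambda>x. c)"
proof (induction n arbitrary: c)
  case (Suc n)
  then show ?case by (intro Ck_on_SucI[where f' = "\<lambda>x v. 0"]) auto
qed auto

lemma Ck_on_add:
  assumes "open S"
  shows "Ck_on n S f \<Longrightarrow> Ck_on n S g \<Longrightarrow> Ck_on n S (\<lambda>x. f x + g x)"
proof (induction n arbitrary: f g)
  case (Suc n)
  show ?case
    by (rule Ck_on_SucI[OF assms has_derivative_add[OF Ck_on_has_derivative Ck_on_has_derivative]])
      (use Suc in auto)
qed (auto intro: continuous_intros)

lemma Ck_on_linear:
  assumes "open S" "bounded_linear h"
  shows "Ck_on n S f \<Longrightarrow> Ck_on n S (\<lambda>x. h (f x))"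
proof (induction n arbitrary: f)
  case 0
  then show ?case
    using bounded_linear.continuous_on[OF assms(2), of S f] by simp
next
  case (Suc n)
  show ?case
    by (rule Ck_on_SucI[OF assms(1) bounded_linear.has_derivative[OF assms(2) Ck_on_has_derivative]])
      (use Suc in auto)
qed

lemma Ck_on_bilinear:
  assumes "open S" "bounded_bilinear h"
  shows "Ck_on n S f \<Longrightarrow> Ck_on n S g \<Longrightarrow> Ck_on n S (\<lambda>x. h (f x) (g x))"
proof (induction n arbitrary: f g)
  case 0
  then show ?case
    using bounded_bilinear.continuous_on[OF assms(2), of S f g] by simp
next
  case (Suc n)
  have "Ck_on n S (\<lambda>x. h (f x) (frechet_derivative g (at x) v) + h (frechet_derivative f (at x) v) (g x))"
    for v
    using Suc.prems Ck_on_SucD[OF Suc.prems(1)] Ck_on_SucD[OF Suc.prems(2)]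
    by (intro Ck_on_add assms Suc.IH) auto
  then show ?case
    by (intro Ck_on_SucI[OF assms(1) bounded_bilinear.FDERIV[OF assms(2)
            Ck_on_has_derivative[OF Suc.prems(1)] Ck_on_has_derivative[OF Suc.prems(2)]]])
qed

lemma Ck_on_sum:
  assumes "open S" "\<And>i. i \<in> I \<Longrightarrow> Ck_on n S (f i)"
  shows "Ck_on n S (\<lambda>x. \<Sum>i\<in>I. f i x)"
  using assms(2)
  by (induction I rule: infinite_finite_induct) (auto intro!: Ck_on_add Ck_on_const assms(1))

lemma Ck_on_mult:
  fixes f g :: "_ \<Rightarrow> real"
  shows "open S \<Longrightarrow> Ck_on n S f \<Longrightarrow> Ck_on n S g \<Longrightarrow> Ck_on n S (\<lambda>x. f x * g x)"
  by (rule Ck_on_bilinear[OF _ bounded_bilinear_mult])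

lemma Ck_on_prod:
  fixes f :: "_ \<Rightarrow> _ \<Rightarrow> real"
  assumes "open S" "\<And>i. i \<in> I \<Longrightarrow> Ck_on n S (f i)"
  shows "Ck_on n S (\<lambda>x. \<Prod>i\<in>I. f i x)"
  using assms(2)
  by (induction I rule: infinite_finite_induct) (auto intro!: Ck_on_mult Ck_on_const assms(1))

lemma Ck_on_minus: "open S \<Longrightarrow> Ck_on n S f \<Longrightarrow> Ck_on n S (\<lambda>x. - f x)"
  by (rule Ck_on_linear[OF _ bounded_linear_minus[OF bounded_linear_ident]])

lemma Ck_on_diff: "open S \<Longrightarrow> Ck_on n S f \<Longrightarrow> Ck_on n S g \<Longrightarrow> Ck_on n S (\<lambda>x. f x - g x)"
  using Ck_on_add[of S n f "\<lambda>x. - g x"] Ck_on_minus[of S n g] by simp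

lemma frechet_derivative_linear: "f differentiable (at x) \<Longrightarrow> linear (frechet_derivative f (at x))"
  by (simp add: frechet_derivative_works has_derivative_linear)

lemma frechet_derivative_Basis_expansion:
  fixes f :: "'a::euclidean_space \<Rightarrow> 'b::real_normed_vector"
  assumes "f differentiable (at x)"
  shows "frechet_derivative f (at x) v = (\<Sum>b\<in>Basis. (v \<bullet> b) *\<^sub>R frechet_derivative f (at x) b)"
proof -
  have "frechet_derivative f (at x) v = frechet_derivative f (at x) (\<Sum>b\<in>Basis. (v \<bullet> b) *\<^sub>R b)"
    by (simp only: euclidean_representation)
  then show ?thesis
    by (simp only: linear_sum[OF frechet_derivative_linear[OF assms]]
        linear_scale[OF frechet_derivative_linear[OF assms]])
qed

text \<open>Expanding the inner derivative in a basis writes each directional derivative of the composition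
  as a sum of products of a directional derivative of \<open>f\<close> and one of \<open>g\<close> composed with \<open>f\<close>, to
  which the induction hypothesis applies.\<close>

lemma Ck_on_compose:
  fixes f :: "'a::real_normed_vector \<Rightarrow> 'b::euclidean_space" and g :: "'b \<Rightarrow> 'c::real_normed_vector"
  assumes "open S" "f ` S \<subseteq> T"
  shows "Ck_on n S f \<Longrightarrow> Ck_on n T g \<Longrightarrow> Ck_on n S (\<lambda>x. g (f x))"
proof (induction n arbitrary: g)
  case 0
  then show ?case
    using continuous_on_compose2[of T g S f] assms by auto
next
  case (Suc n)
  have "((\<lambda>x. g (f x)) has_derivative
      (\<lambda>v. frechet_derivative g (at (f x)) (frechet_derivative f (at x) v))) (at x)" if "x \<in> S" for x
    using has_derivative_compose[OF Ck_on_has_derivative[OF Suc.prems(1) that]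
        Ck_on_has_derivative[OF Suc.prems(2)]] assms that by auto
  then have D: "((\<lambda>x. g (f x)) has_derivative
      (\<lambda>v. \<Sum>b\<in>Basis. (frechet_derivative f (at x) v \<bullet> b) *\<^sub>R frechet_derivative g (at (f x)) b)) (at x)"
    if "x \<in> S" for x
    using that assms(2)
    by (subst frechet_derivative_Basis_expansion[OF Ck_on_differentiable[OF Suc.prems(2)], symmetric]) auto
  have "Ck_on n S (\<lambda>x. frechet_derivative f (at x) v \<bullet> b)" for v b
    using Suc.prems(1) by (intro Ck_on_linear[OF assms(1) bounded_linear_inner_left]) auto
  moreover have "Ck_on n S (\<lambda>x. frechet_derivative g (at (f x)) b)" for b
    using Suc.prems by (intro Suc.IH Ck_on_SucD[OF Suc.prems(1)]) auto
  ultimately show ?case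
    by (intro Ck_on_SucI[OF assms(1) D] Ck_on_sum Ck_on_bilinear[OF _ bounded_bilinear_scaleR] assms)
qed

lemma Ck_on_directional_derivative:
  fixes f :: "'a::euclidean_space \<Rightarrow> 'b::real_normed_vector"
  assumes "open S" "Ck_on (Suc n) S f" "Ck_on n S Y"
  shows "Ck_on n S (\<lambda>x. frechet_derivative f (at x) (Y x))"
proof -
  have "Ck_on n S (\<lambda>x. \<Sum>b\<in>Basis. (Y x \<bullet> b) *\<^sub>R frechet_derivative f (at x) b)"
    using assms
    by (intro Ck_on_sum Ck_on_bilinear[OF _ bounded_bilinear_scaleR]
        Ck_on_linear[OF _ bounded_linear_inner_left]) auto
  then show ?thesis
    by (rule Ck_on_cong_open[OF assms(1), rotated])
      (rule frechet_derivative_Basis_expansion[OF Ck_on_differentiable[OF assms(2)], symmetric])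
qed

text \<open>The mean value theorem in the direction \<open>u\<close>, and then in the direction \<open>v\<close>. The left side is
  symmetric in \<open>u\<close> and \<open>v\<close>, which gives the symmetry of the second derivative in the limit.\<close>

lemma second_difference_mean_value:
  fixes f :: "'a::real_normed_vector \<Rightarrow> real"
  assumes f: "Ck_on 2 S f" and h: "0 < h"
    and S: "\<And>s t. 0 \<le> s \<Longrightarrow> s \<le> h \<Longrightarrow> 0 \<le> t \<Longrightarrow> t \<le> h \<Longrightarrow> x + s *\<^sub>R u + t *\<^sub>R v \<in> S"
  shows "\<exists>s t. 0 < s \<and> s < h \<and> 0 < t \<and> t < h \<and>
    f (x + h *\<^sub>R u + h *\<^sub>R v) - f (x + h *\<^sub>R u) - f (x + h *\<^sub>R v) + f x =
      h * (h * frechet_derivative (\<lambda>y. frechet_derivative f (at y) u) (at (x + s *\<^sub>R u + t *\<^sub>R v)) v)"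
proof -
  let ?D = "\<lambda>y. frechet_derivative f (at y) u"
  have f1: "Ck_on (Suc (Suc 0)) S f" using f by (simp add: numeral_2_eq_2)
  then have f2: "Ck_on (Suc 0) S ?D" by simp
  have lin: "linear (frechet_derivative f (at y))" "linear (frechet_derivative ?D (at y))" if "y \<in> S" for y
    using f1 f2 that by (auto intro!: frechet_derivative_linear)
  have in1: "((\<lambda>s. x + s *\<^sub>R u + t *\<^sub>R v) has_derivative (\<lambda>r. r *\<^sub>R u)) (at s)" for t v s
    by (auto intro!: derivative_eq_intros)
  have in2: "((\<lambda>t. x + s *\<^sub>R u + t *\<^sub>R v) has_derivative (\<lambda>r. r *\<^sub>R v)) (at t)" for s t
    by (auto intro!: derivative_eq_intros)
  have d1: "((\<lambda>s. f (x + s *\<^sub>R u + t *\<^sub>R v)) has_real_derivative ?D (x + s *\<^sub>R u + t *\<^sub>R v)) (at s)"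
    if "0 \<le> s" "s \<le> h" "0 \<le> t" "t \<le> h" for s t
    using has_derivative_compose[OF in1[of t v s] Ck_on_has_derivative[OF f1 S[OF that]]]
    unfolding has_field_derivative_def
    by (simp add: linear_scale[OF lin(1)[OF S[OF that]]] mult.commute[of _ "?D _"])
  have d2: "((\<lambda>t. ?D (x + s *\<^sub>R u + t *\<^sub>R v)) has_real_derivative
      frechet_derivative ?D (at (x + s *\<^sub>R u + t *\<^sub>R v)) v) (at t)"
    if "0 \<le> s" "s \<le> h" "0 \<le> t" "t \<le> h" for s t
    using has_derivative_compose[OF in2[of s t] Ck_on_has_derivative[OF f2 S[OF that]]]
    unfolding has_field_derivative_def
    by (simp add: linear_scale[OF lin(2)[OF S[OF that]]] mult.commute[of _ "frechet_derivative ?D _ v"])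
  have "\<exists>s>0. s < h \<and>
    (f (x + h *\<^sub>R u + h *\<^sub>R v) - f (x + h *\<^sub>R u + 0 *\<^sub>R v)) - (f (x + 0 *\<^sub>R u + h *\<^sub>R v) - f (x + 0 *\<^sub>R u + 0 *\<^sub>R v)) =
     (h - 0) * (?D (x + s *\<^sub>R u + h *\<^sub>R v) - ?D (x + s *\<^sub>R u + 0 *\<^sub>R v))"
    using h by (intro MVT2 DERIV_diff d1) auto
  then obtain s where s: "0 < s" "s < h"
    "f (x + h *\<^sub>R u + h *\<^sub>R v) - f (x + h *\<^sub>R u) - f (x + h *\<^sub>R v) + f x =
     h * (?D (x + s *\<^sub>R u + h *\<^sub>R v) - ?D (x + s *\<^sub>R u + 0 *\<^sub>R v))"
    by auto
  have "\<exists>t>0. t < h \<and> ?D (x + s *\<^sub>R u + h *\<^sub>R v) - ?D (x + s *\<^sub>R u + 0 *\<^sub>R v) =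
     (h - 0) * frechet_derivative ?D (at (x + s *\<^sub>R u + t *\<^sub>R v)) v"
    using h s(1,2) by (intro MVT2 d2) auto
  then show ?thesis using s by auto
qed

text \<open>If the two mixed derivatives differed at \<open>x\<close>, then by continuity they would take no common
  value near \<open>x\<close>; but on every small parallelogram the second difference provides one.\<close>

lemma second_derivative_symmetric_real:
  fixes f :: "'a::real_normed_vector \<Rightarrow> real"
  assumes "open S" "Ck_on 2 S f" "x \<in> S"
  shows "frechet_derivative (\<lambda>y. frechet_derivative f (at y) u) (at x) v =
    frechet_derivative (\<lambda>y. frechet_derivative f (at y) v) (at x) u"
proof (rule ccontr)
  let ?D = "\<lambda>u v y. frechet_derivative (\<lambda>y. frechet_derivative f (at y) u) (at y) v"
  assume neq: "?D u v x \<noteq> ?D v u x"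
  define e where "e = \<bar>?D u v x - ?D v u x\<bar> / 2"
  have e: "e > 0" using neq by (simp add: e_def)
  have cont: "continuous_on S (?D a b)" for a b
    using assms(2) by (simp add: numeral_2_eq_2)
  have "\<exists>d>0. \<forall>y. dist y x < d \<longrightarrow> y \<in> S \<and> \<bar>?D a b y - ?D a b x\<bar> < e" for a b
  proof -
    have "isCont (?D a b) x"
      using cont assms(1,3) by (simp add: continuous_on_eq_continuous_at)
    then obtain d1 where "d1 > 0" "\<And>y. dist y x < d1 \<Longrightarrow> \<bar>?D a b y - ?D a b x\<bar> < e"
      using e by (auto simp: continuous_at_eps_delta dist_real_def)
    moreover obtain d2 where "d2 > 0" "\<And>y. dist y x < d2 \<Longrightarrow> y \<in> S"
      using assms(1,3) unfolding open_dist by blast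
    ultimately show ?thesis by (intro exI[of _ "min d1 d2"]) auto
  qed
  from this[of u v] this[of v u]
  obtain d1 d2 where d1: "d1 > 0" "\<And>y. dist y x < d1 \<Longrightarrow> y \<in> S \<and> \<bar>?D u v y - ?D u v x\<bar> < e"
    and d2: "d2 > 0" "\<And>y. dist y x < d2 \<Longrightarrow> y \<in> S \<and> \<bar>?D v u y - ?D v u x\<bar> < e"
    by blast
  define d where "d = min d1 d2"
  have d: "d > 0" using d1 d2 by (simp add: d_def)
  \<comment> \<open>The parallelogram spanned by \<open>h u\<close> and \<open>h v\<close> at \<open>x\<close> stays within distance \<open>d\<close>; the summand
     1 keeps the denominator positive when \<open>u = v = 0\<close>.\<close>
  define h where "h = d / (2 * (norm u + norm v + 1))"
  have h: "h > 0" using d by (auto simp: h_def intro!: divide_pos_pos add_nonneg_pos)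
  have near: "dist (x + s *\<^sub>R u + t *\<^sub>R v) x < d" if "0 \<le> s" "s \<le> h" "0 \<le> t" "t \<le> h" for s t
  proof -
    have "dist (x + s *\<^sub>R u + t *\<^sub>R v) x \<le> s * norm u + t * norm v"
      using norm_triangle_ineq[of "s *\<^sub>R u" "t *\<^sub>R v"] that by (simp add: dist_norm add.assoc)
    also have "\<dots> \<le> h * norm u + h * norm v"
      using that by (intro add_mono mult_right_mono) auto
    also have "\<dots> < h * (2 * (norm u + norm v + 1))"
      using h by (simp add: algebra_simps add_nonneg_pos)
    also have "\<dots> = d"
      by (simp add: h_def add_nonneg_pos less_imp_neq[symmetric])
    finally show ?thesis .
  qed
  have in_d1: "dist (x + s *\<^sub>R u + t *\<^sub>R v) x < d1" if "0 \<le> s" "s \<le> h" "0 \<le> t" "t \<le> h" for s t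
    using near[OF that] by (simp add: d_def)
  obtain s t where st: "0 < s" "s < h" "0 < t" "t < h"
    "f (x + h *\<^sub>R u + h *\<^sub>R v) - f (x + h *\<^sub>R u) - f (x + h *\<^sub>R v) + f x =
      h * (h * ?D u v (x + s *\<^sub>R u + t *\<^sub>R v))"
    using second_difference_mean_value[OF assms(2) h, of x u v, OF d1(2)[THEN conjunct1, OF in_d1]] by blast
  have near': "dist (x + t *\<^sub>R v + s *\<^sub>R u) x < d" if "0 \<le> t" "t \<le> h" "0 \<le> s" "s \<le> h" for s t
    using near[OF that(3,4,1,2)] by (simp add: algebra_simps)
  have in_d1': "dist (x + t *\<^sub>R v + s *\<^sub>R u) x < d1" if "0 \<le> t" "t \<le> h" "0 \<le> s" "s \<le> h" for s t
    using near'[OF that] by (simp add: d_def)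
  obtain t' s' where st': "0 < t'" "t' < h" "0 < s'" "s' < h"
    "f (x + h *\<^sub>R v + h *\<^sub>R u) - f (x + h *\<^sub>R v) - f (x + h *\<^sub>R u) + f x =
      h * (h * ?D v u (x + t' *\<^sub>R v + s' *\<^sub>R u))"
    using second_difference_mean_value[OF assms(2) h, of x v u, OF d1(2)[THEN conjunct1, OF in_d1']] by blast
  have "h * (h * ?D u v (x + s *\<^sub>R u + t *\<^sub>R v)) = h * (h * ?D v u (x + t' *\<^sub>R v + s' *\<^sub>R u))"
    using st(5) st'(5) by (simp add: algebra_simps)
  then have "?D u v (x + s *\<^sub>R u + t *\<^sub>R v) = ?D v u (x + t' *\<^sub>R v + s' *\<^sub>R u)"
    using h by simp
  moreover have "\<bar>?D u v (x + s *\<^sub>R u + t *\<^sub>R v) - ?D u v x\<bar> < e"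
    using near[of s t] st d1(2) by (simp add: d_def)
  moreover have "\<bar>?D v u (x + t' *\<^sub>R v + s' *\<^sub>R u) - ?D v u x\<bar> < e"
    using near'[of t' s'] st' d2(2) by (simp add: d_def)
  moreover have False if "a = b" "\<bar>a - p\<bar> < \<bar>p - q\<bar> / 2" "\<bar>b - q\<bar> < \<bar>p - q\<bar> / 2" for a b p q :: real
    using that by (auto simp: abs_if field_simps split: if_splits)
  ultimately show False unfolding e_def by blast
qed

lemma frechet_derivative_inner:
  "f differentiable (at x) \<Longrightarrow>
    frechet_derivative (\<lambda>y. f y \<bullet> b) (at x) v = frechet_derivative f (at x) v \<bullet> b"
  using frechet_derivative_at[OF has_derivative_inner_left[of f "frechet_derivative f (at x)"], of x b]
  by (simp add: frechet_derivative_works fun_eq_iff)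

lemma second_derivative_symmetric:
  fixes f :: "'a::real_normed_vector \<Rightarrow> 'b::euclidean_space"
  assumes S: "open S" and f: "Ck_on 2 S f" and x: "x \<in> S"
  shows "frechet_derivative (\<lambda>y. frechet_derivative f (at y) u) (at x) v =
    frechet_derivative (\<lambda>y. frechet_derivative f (at y) v) (at x) u"
proof (rule euclidean_eqI)
  fix b :: 'b
  have f1: "Ck_on (Suc (Suc 0)) S f" using f by (simp add: numeral_2_eq_2)
  have eq: "frechet_derivative (\<lambda>y. frechet_derivative (\<lambda>z. f z \<bullet> b) (at y) u) (at x) v =
    frechet_derivative (\<lambda>y. frechet_derivative f (at y) u) (at x) v \<bullet> b" for u v
  proof -
    have "frechet_derivative (\<lambda>y. frechet_derivative (\<lambda>z. f z \<bullet> b) (at y) u) (at x) =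
      frechet_derivative (\<lambda>y. frechet_derivative f (at y) u \<bullet> b) (at x)"
      using f1 by (intro frechet_derivative_cong_open[OF S x] frechet_derivative_inner) auto
    then show ?thesis
      using f1 x by (simp add: frechet_derivative_inner)
  qed
  have "Ck_on 2 S (\<lambda>z. f z \<bullet> b)"
    by (rule Ck_on_linear[OF S bounded_linear_inner_left f])
  from second_derivative_symmetric_real[OF S this x, of u v]
  show "frechet_derivative (\<lambda>y. frechet_derivative f (at y) u) (at x) v \<bullet> b =
    frechet_derivative (\<lambda>y. frechet_derivative f (at y) v) (at x) u \<bullet> b"
    by (simp only: eq)
qed

text \<open>The product rule for \<open>DF\<close> applied to \<open>Z\<close>, where the first summand on the right keeps the vector
  \<open>Z x\<close> fixed and so is the second derivative of \<open>F\<close>.\<close>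

lemma frechet_derivative_of_pushforward:
  fixes F :: "'a::euclidean_space \<Rightarrow> 'b::real_normed_vector"
  assumes S: "open S" and F: "Ck_on 2 S F" and Z: "Z differentiable (at x)" and x: "x \<in> S"
  shows "frechet_derivative (\<lambda>y. frechet_derivative F (at y) (Z y)) (at x) v =
    frechet_derivative (\<lambda>y. frechet_derivative F (at y) (Z x)) (at x) v +
    frechet_derivative F (at x) (frechet_derivative Z (at x) v)"
proof -
  let ?D = "\<lambda>b y. frechet_derivative F (at y) b"
  have F1: "Ck_on (Suc (Suc 0)) S F" using F by (simp add: numeral_2_eq_2)
  have diff: "F differentiable (at y)" "?D b differentiable (at y)" if "y \<in> S" for y b
    using F1 that by auto
  have exp: "?D w y = (\<Sum>b\<in>Basis. (w \<bullet> b) *\<^sub>R ?D b y)" if "y \<in> S" for w y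
    by (rule frechet_derivative_Basis_expansion[OF diff(1)[OF that]])
  have dD: "(?D b has_derivative frechet_derivative (?D b) (at x)) (at x)" for b
    using diff(2)[OF x] by (simp add: frechet_derivative_works)
  have dZ: "((\<lambda>y. Z y \<bullet> b) has_derivative (\<lambda>v. frechet_derivative Z (at x) v \<bullet> b)) (at x)" for b
    using Z by (intro has_derivative_inner_left) (simp add: frechet_derivative_works)
  have 1: "((\<lambda>y. \<Sum>b\<in>Basis. (Z y \<bullet> b) *\<^sub>R ?D b y) has_derivative
     (\<lambda>v. \<Sum>b\<in>Basis. (Z x \<bullet> b) *\<^sub>R frechet_derivative (?D b) (at x) v +
        (frechet_derivative Z (at x) v \<bullet> b) *\<^sub>R ?D b x)) (at x)"
    by (intro has_derivative_sum has_derivative_scaleR dD dZ)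
  have 2: "((\<lambda>y. \<Sum>b\<in>Basis. (Z x \<bullet> b) *\<^sub>R ?D b y) has_derivative
     (\<lambda>v. \<Sum>b\<in>Basis. (Z x \<bullet> b) *\<^sub>R frechet_derivative (?D b) (at x) v)) (at x)"
    by (intro has_derivative_sum has_derivative_scaleR_right dD)
  have "frechet_derivative (\<lambda>y. ?D (Z y) y) (at x) =
      frechet_derivative (\<lambda>y. \<Sum>b\<in>Basis. (Z y \<bullet> b) *\<^sub>R ?D b y) (at x)"
    by (intro frechet_derivative_cong_open[OF S x] exp)
  moreover have "frechet_derivative (\<lambda>y. ?D (Z x) y) (at x) =
      frechet_derivative (\<lambda>y. \<Sum>b\<in>Basis. (Z x \<bullet> b) *\<^sub>R ?D b y) (at x)"
    by (intro frechet_derivative_cong_open[OF S x] exp)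
  ultimately show ?thesis
    by (simp add: frechet_derivative_at[OF 1, symmetric] frechet_derivative_at[OF 2, symmetric]
        sum.distrib exp[OF x, of "frechet_derivative Z (at x) v"])
qed

text \<open>The second derivatives of \<open>F\<close> cancel by symmetry. The right side contains only the pushed
  forward fields \<open>DF Y\<close> and \<open>DF Z\<close>, so relations for these can be differentiated.\<close>

lemma pushforward_lie_bracket:
  fixes F :: "'a::euclidean_space \<Rightarrow> 'b::euclidean_space"
  assumes S: "open S" and F: "Ck_on 2 S F" and x: "x \<in> S"
    and YZ: "Y differentiable (at x)" "Z differentiable (at x)"
  shows "frechet_derivative F (at x) (lie_bracket Y Z x) =
    frechet_derivative (\<lambda>y. frechet_derivative F (at y) (Z y)) (at x) (Y x) -
    frechet_derivative (\<lambda>y. frechet_derivative F (at y) (Y y)) (at x) (Z x)"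
proof -
  have lin: "linear (frechet_derivative F (at x))"
    using F x by (intro frechet_derivative_linear) (simp add: numeral_2_eq_2)
  show ?thesis
    unfolding frechet_derivative_of_pushforward[OF S F YZ(1) x]
      frechet_derivative_of_pushforward[OF S F YZ(2) x]
    using second_derivative_symmetric[OF S F x, of "Z x" "Y x"]
    by (simp add: lie_bracket_def linear_diff[OF lin])
qed

section \<open>Jacobians and star fields\<close>

lemma jacobian_mult_vec:
  fixes f :: "real ^ 'n \<Rightarrow> real ^ 'm"
  shows "f differentiable (at x) \<Longrightarrow> jacobian f (at x) *v v = frechet_derivative f (at x) v"
  by (simp only: jacobian_def matrix_vector_mul(2)[OF frechet_derivative_linear])

lemma jacobian_nth:
  "jacobian f (at x) $ i $ j = frechet_derivative f (at x) (axis j 1) $ i"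
  by (simp add: jacobian_def matrix_def)

lemma jacobian_compose:
  fixes f :: "real ^ 'n \<Rightarrow> real ^ 'm" and g :: "real ^ 'm \<Rightarrow> real ^ 'l"
  assumes "f differentiable (at x)" "g differentiable (at (f x))"
  shows "jacobian (g \<circ> f) (at x) = jacobian g (at (f x)) ** jacobian f (at x)"
proof -
  have "(g \<circ> f has_derivative frechet_derivative g (at (f x)) \<circ> frechet_derivative f (at x)) (at x)"
    using assms by (intro diff_chain_at) (auto simp: frechet_derivative_works)
  from frechet_derivative_at[OF this]
  have "frechet_derivative (g \<circ> f) (at x) = frechet_derivative g (at (f x)) \<circ> frechet_derivative f (at x)"
    by simp
  then show ?thesis
    unfolding jacobian_def
    using matrix_compose[OF frechet_derivative_linear[OF assms(1)] frechet_derivative_linear[OF assms(2)]]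
    by simp
qed

lemma star_field_eq_star_vec:
  fixes p :: "real ^ 'd::{finite,linorder} \<Rightarrow> real ^ 'e::{finite,linorder}"
  assumes "p differentiable (at x)"
  shows "star_field p x = star_vec (jacobian p (at x))"
proof -
  have comp: "frechet_derivative (\<lambda>y. p y $ a) (at x) v = frechet_derivative p (at x) v $ a" for a v
    using frechet_derivative_inner[OF assms, of "axis a 1" v] by (simp add: inner_axis)
  show ?thesis
    by (simp add: star_field_def star_vec_def sharp_def hodge_star_def wedge_def comp jacobian_nth
        axis_def if_distrib[of "\<lambda>c. _ * c"] vec_eq_iff cong: if_cong)
qed

lemma Ck_on_vec_lambda:
  assumes S: "open S" and f: "\<And>i. Ck_on n S (\<lambda>x. f x i)"
  shows "Ck_on n S (\<lambda>x. \<chi> i. f x i :: real ^ 'n)"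
proof -
  have "(\<chi> i. f x i :: real ^ 'n) = (\<Sum>i\<in>UNIV. f x i *\<^sub>R axis i 1)" for x
    using basis_expansion[of "\<chi> i. f x i"] by (simp add: scalar_mult_eq_scaleR)
  then show ?thesis
    using f by (simp only:) (intro Ck_on_sum Ck_on_bilinear[OF _ bounded_bilinear_scaleR] Ck_on_const S)
qed

lemma Ck_on_det:
  fixes A :: "'a::real_normed_vector \<Rightarrow> real ^ 'n ^ 'n"
  assumes "open S" "\<And>i j. Ck_on n S (\<lambda>x. A x $ i $ j)"
  shows "Ck_on n S (\<lambda>x. det (A x))"
  unfolding det_def using assms by (intro Ck_on_sum Ck_on_mult Ck_on_prod Ck_on_const)

lemma Ck_on_jacobian_nth:
  assumes "open S" "Ck_on (Suc n) S f"
  shows "Ck_on n S (\<lambda>x. jacobian f (at x) $ i $ j)"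
  unfolding jacobian_nth using assms by (intro Ck_on_linear[OF _ bounded_linear_vec_nth]) auto

lemma Ck_on_star_field:
  fixes p :: "real ^ 'd::{finite,linorder} \<Rightarrow> real ^ 'e::{finite,linorder}"
  assumes S: "open S" and p: "Ck_on (Suc n) S p"
  shows "Ck_on n S (star_field p)"
proof -
  have "Ck_on n S (\<lambda>x. star_vec (jacobian p (at x)))"
    unfolding star_vec_def
    by (intro Ck_on_vec_lambda Ck_on_mult Ck_on_const Ck_on_det S)
      (simp add: Ck_on_jacobian_nth[OF S p])
  then show ?thesis
    by (rule Ck_on_cong_open[OF S, rotated])
      (simp add: star_field_eq_star_vec Ck_on_differentiable[OF p])
qed

section \<open>Word fields\<close>

lemma lambda_rows: "lambda X I x = det (\<chi> a. word_field X (I a) x)"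
  unfolding lambda_def
  by (subst det_transpose[symmetric]) (simp add: Finite_Cartesian_Product.transpose_def)

lemma Ck_on_lie_bracket:
  fixes Y Z :: "'a::euclidean_space \<Rightarrow> 'a"
  assumes "open S" "Ck_on (Suc n) S Y" "Ck_on (Suc n) S Z"
  shows "Ck_on n S (lie_bracket Y Z)"
  unfolding lie_bracket_def[abs_def]
  using assms by (intro Ck_on_diff Ck_on_directional_derivative Ck_on_SucD[of n S Y] Ck_on_SucD[of n S Z])

lemma Ck_on_word_field:
  fixes X :: "nat \<Rightarrow> 'a::euclidean_space \<Rightarrow> 'a"
  assumes S: "open S" and X: "\<And>j n. j \<in> {1..k} \<Longrightarrow> Ck_on n S (X j)"
  shows "w \<in> words k \<Longrightarrow> Ck_on n S (word_field X w)"
proof (induction w arbitrary: n rule: rev_induct)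
  case (snoc i w)
  then have "i \<in> {1..k}" by (simp add: words_def)
  show ?case
  proof (cases "w = []")
    case False
    then have "w \<in> words k" using snoc.prems by (simp add: words_def)
    then show ?thesis
      unfolding word_field_snoc[OF False]
      by (intro Ck_on_lie_bracket S snoc.IH X \<open>i \<in> {1..k}\<close>)
  next
    case True
    then show ?thesis
      using X[OF \<open>i \<in> {1..k}\<close>] by (simp only: append_Nil word_field_single)
  qed
qed (simp add: words_def)

lemma has_derivative_sum_list:
  assumes "\<And>p. p \<in> set L \<Longrightarrow> (f p has_derivative f' p) F"
  shows "((\<lambda>y. \<Sum>p\<leftarrow>L. f p y) has_derivative (\<lambda>v. \<Sum>p\<leftarrow>L. f' p v)) F"
  using assms by (induction L) (auto intro!: has_derivative_add)

lemma linear_sum_list: "linear h \<Longrightarrow> h (\<Sum>p\<leftarrow>L. f p) = (\<Sum>p\<leftarrow>L. h (f p))"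
  by (induction L) (simp_all add: linear_0 linear_add)

text \<open>One step in the expansion of a word: the bracket of a field related to \<open>\<Sum>c A\<^sub>i\<close> with one related
  to \<open>g B\<close>. Only the first sum contains brackets; in the others a coefficient has been
  differentiated and one of the two factors is lost. A list of pairs is used since the same field
  may occur several times.\<close>

lemma pushforward_bracket_combination:
  fixes F :: "'a::euclidean_space \<Rightarrow> 'b::euclidean_space"
    and A :: "'i \<Rightarrow> 'b \<Rightarrow> 'b" and L :: "(('a \<Rightarrow> real) \<times> 'i) list"
  assumes S: "open S" and F: "Ck_on 2 S F" and x: "x \<in> S"
    and dYZ: "Y differentiable (at x)" "Z differentiable (at x)"
    and Y: "\<And>y. y \<in> S \<Longrightarrow> frechet_derivative F (at y) (Y y) = (\<Sum>p\<leftarrow>L. fst p y *\<^sub>R A (snd p) (F y))"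
    and Z: "\<And>y. y \<in> S \<Longrightarrow> frechet_derivative F (at y) (Z y) = g y *\<^sub>R B (F y)"
    and dL: "\<And>p. p \<in> set L \<Longrightarrow> fst p differentiable (at x) \<and> A (snd p) differentiable (at (F x))"
    and dg: "g differentiable (at x)" and dB: "B differentiable (at (F x))"
  shows "frechet_derivative F (at x) (lie_bracket Y Z x) =
    (\<Sum>p\<leftarrow>L. (g x * fst p x) *\<^sub>R lie_bracket (A (snd p)) B (F x)) +
    (\<Sum>p\<leftarrow>L. (- frechet_derivative (fst p) (at x) (Z x)) *\<^sub>R A (snd p) (F x)) +
    frechet_derivative g (at x) (Y x) *\<^sub>R B (F x)"
proof -
  let ?DF = "frechet_derivative F (at x)" and ?DB = "frechet_derivative B (at (F x))"
  let ?DA = "\<lambda>i. frechet_derivative (A i) (at (F x))"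
  have dF: "F differentiable (at x)" using F x by (simp add: numeral_2_eq_2)
  \<comment> \<open>The product and chain rules for one summand.\<close>
  have term_deriv: "((\<lambda>y. c y *\<^sub>R C (F y)) has_derivative (\<lambda>v. c x *\<^sub>R frechet_derivative C (at (F x)) (?DF v)
      + frechet_derivative c (at x) v *\<^sub>R C (F x))) (at x)"
    if "c differentiable (at x)" "C differentiable (at (F x))" for c and C :: "'b \<Rightarrow> 'b"
    using that dF unfolding frechet_derivative_works
    by (intro has_derivative_scaleR) (auto intro: has_derivative_compose)
  have "frechet_derivative (\<lambda>y. frechet_derivative F (at y) (Z y)) (at x) =
      frechet_derivative (\<lambda>y. g y *\<^sub>R B (F y)) (at x)"
    by (rule frechet_derivative_cong_open[OF S x Z])
  then have DZ: "frechet_derivative (\<lambda>y. frechet_derivative F (at y) (Z y)) (at x) (Y x) =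
      g x *\<^sub>R ?DB (?DF (Y x)) + frechet_derivative g (at x) (Y x) *\<^sub>R B (F x)"
    by (simp add: frechet_derivative_at[OF term_deriv[OF dg dB], symmetric])
  have "frechet_derivative (\<lambda>y. frechet_derivative F (at y) (Y y)) (at x) =
      frechet_derivative (\<lambda>y. \<Sum>p\<leftarrow>L. fst p y *\<^sub>R A (snd p) (F y)) (at x)"
    by (rule frechet_derivative_cong_open[OF S x Y])
  also have "\<dots> = (\<lambda>v. \<Sum>p\<leftarrow>L. fst p x *\<^sub>R ?DA (snd p) (?DF v) + frechet_derivative (fst p) (at x) v *\<^sub>R A (snd p) (F x))"
    by (rule frechet_derivative_at[symmetric], rule has_derivative_sum_list) (rule term_deriv[OF dL[THEN conjunct1] dL[THEN conjunct2]])
  finally have DY: "frechet_derivative (\<lambda>y. frechet_derivative F (at y) (Y y)) (at x) (Z x) =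
      (\<Sum>p\<leftarrow>L. fst p x *\<^sub>R ?DA (snd p) (?DF (Z x)) + frechet_derivative (fst p) (at x) (Z x) *\<^sub>R A (snd p) (F x))"
    by simp
  have linB: "linear ?DB" using dB by (rule frechet_derivative_linear)
  have "g x *\<^sub>R (\<Sum>p\<leftarrow>L. fst p x *\<^sub>R ?DB (A (snd p) (F x))) -
     (\<Sum>p\<leftarrow>L. fst p x *\<^sub>R ?DA (snd p) (g x *\<^sub>R B (F x)) + frechet_derivative (fst p) (at x) (Z x) *\<^sub>R A (snd p) (F x)) =
    (\<Sum>p\<leftarrow>L. (g x * fst p x) *\<^sub>R lie_bracket (A (snd p)) B (F x)) +
    (\<Sum>p\<leftarrow>L. (- frechet_derivative (fst p) (at x) (Z x)) *\<^sub>R A (snd p) (F x))"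
    using dL
  proof (induction L)
    case (Cons p L)
    have lin: "linear (?DA (snd p))" using Cons.prems by (intro frechet_derivative_linear) auto
    note IH = Cons.IH[OF Cons.prems[OF list.set_intros(2)]]
    then show ?case
      by (simp add: lie_bracket_def linear_scale[OF lin] algebra_simps)
  qed simp
  then show ?thesis
    unfolding pushforward_lie_bracket[OF S F x dYZ] DZ DY
    unfolding Y[OF x] Z[OF x] linear_sum_list[OF linB] linear_scale[OF linB]
    by (simp add: add_diff_eq[symmetric] add.commute diff_add_eq[symmetric])
qed

lemma prec_snoc:
  "prec k (count_list v) (count_list w) \<Longrightarrow> prec k (count_list (v @ [i])) (count_list (w @ [i]))"
  by (auto simp: prec_def)

lemma prec_append_letter:
  assumes "i \<in> {1..k}" "v = w \<or> prec k (count_list v) (count_list w)"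
  shows "prec k (count_list v) (count_list (w @ [i]))"
proof -
  have le: "count_list v j \<le> count_list w j" if "j \<in> {1..k}" for j
    using assms(2) that by (auto simp: prec_def)
  show ?thesis
    using assms(2)
  proof
    assume "v = w"
    then show ?thesis using assms(1) by (auto simp: prec_def intro!: bexI[of _ i])
  next
    assume "prec k (count_list v) (count_list w)"
    then obtain j where "j \<in> {1..k}" "count_list v j < count_list w j"
      by (auto simp: prec_def)
    then show ?thesis
      unfolding prec_def using le by (auto intro!: bexI[of _ j] le_SucI)
  qed
qed

lemma prec_single:
  assumes "w \<in> words k" "i \<in> {1..k}"
  shows "prec k (count_list [i]) (count_list (w @ [i]))"
proof -
  obtain j where "j \<in> set w" "j \<in> {1..k}" using assms(1) by (cases w) (auto simp: words_def)
  then have "0 < count_list w j" by (metis count_list_0_iff gr0I)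
  then show ?thesis using \<open>j \<in> {1..k}\<close> by (force simp: prec_def)
qed

lemma prec_deg:
  assumes le: "\<And>a j. j \<in> {1..k} \<Longrightarrow> count_list (I' a) j \<le> count_list (I a) j"
    and less: "prec k (count_list (I' b)) (count_list (I b))"
  shows "prec k (deg I') (deg I)"
proof -
  obtain i where i: "i \<in> {1..k}" "count_list (I' b) i < count_list (I b) i"
    using less by (auto simp: prec_def)
  have "deg I' i < deg I i"
    unfolding deg_def using i le by (intro sum_strict_mono_ex1) auto
  moreover have "deg I' j \<le> deg I j" if "j \<in> {1..k}" for j
    unfolding deg_def using le that by (intro sum_mono) auto
  ultimately show ?thesis using i by (auto simp: prec_def)
qed

text \<open>Collects the factors of a word by letters.\<close>

lemma prod_list_letters:
  fixes h :: "nat \<Rightarrow> 'a::comm_monoid_mult"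
  shows "set w \<subseteq> {1..k} \<Longrightarrow> (\<Prod>i\<leftarrow>w. h i) = (\<Prod>j=1..k. h j ^ count_list w j)"
proof (induction w)
  case (Cons i w)
  have "(\<Prod>j=1..k. h j ^ count_list (i # w) j) =
      (\<Prod>j=1..k. (if j = i then h j else 1) * h j ^ count_list w j)"
    by (intro prod.cong) auto
  also have "\<dots> = h i * (\<Prod>j=1..k. h j ^ count_list w j)"
    using Cons.prems by (subst prod.distrib) (simp add: prod.delta)
  finally show ?case using Cons by simp
qed simp

section \<open>Brackets of related fields\<close>

text \<open>The fields \<open>X' j\<close> are \<open>F\<close>-related to \<open>X j\<close> up to the factor \<open>f j\<close>. Since \<open>F\<close> may be singular,
  this relation does not determine \<open>X' j\<close>.\<close>

locale related_fields =
  fixes k :: nat and S :: "(real ^ 'd) set" and F :: "real ^ 'd \<Rightarrow> real ^ 'd"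
    and X X' :: "nat \<Rightarrow> real ^ 'd \<Rightarrow> real ^ 'd" and f :: "nat \<Rightarrow> real ^ 'd \<Rightarrow> real"
  assumes S: "open S" and F: "\<And>n. Ck_on n S F" and F_into: "F ` S \<subseteq> S"
    and X: "\<And>j n. j \<in> {1..k} \<Longrightarrow> Ck_on n S (X j)"
    and X': "\<And>j n. j \<in> {1..k} \<Longrightarrow> Ck_on n S (X' j)"
    and f: "\<And>j n. j \<in> {1..k} \<Longrightarrow> Ck_on n S (f j)"
    and related: "\<And>j y. j \<in> {1..k} \<Longrightarrow> y \<in> S \<Longrightarrow>
      frechet_derivative F (at y) (X' j y) = f j y *\<^sub>R X j (F y)"
begin

lemma F_differentiable: "y \<in> S \<Longrightarrow> F differentiable (at y)"
  using Ck_on_differentiable[OF F] .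

lemma Ck_on_word_X: "w \<in> words k \<Longrightarrow> Ck_on n S (word_field X w)"
  by (rule Ck_on_word_field[OF S X])

lemma Ck_on_word_X': "w \<in> words k \<Longrightarrow> Ck_on n S (word_field X' w)"
  by (rule Ck_on_word_field[OF S X'])

text \<open>The leading coefficient is multiplicative along the word; the terms in which a derivative falls
  on a coefficient have lost the last letter, or all letters but the last, and so have lower
  degree.\<close>

lemma pushforward_word_field:
  "w \<in> words k \<Longrightarrow> \<exists>L.
    (\<forall>p\<in>set L. (\<forall>n. Ck_on n S (fst p)) \<and> snd p \<in> words k \<and>
      prec k (count_list (snd p)) (count_list w)) \<and>
    (\<forall>y\<in>S. frechet_derivative F (at y) (word_field X' w y) =
      (\<Prod>i\<leftarrow>w. f i y) *\<^sub>R word_field X w (F y) +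
      (\<Sum>p\<leftarrow>L. fst p y *\<^sub>R word_field X (snd p) (F y)))"
proof (induction w rule: rev_induct)
  case (snoc i w)
  then have i: "i \<in> {1..k}" by (simp add: words_def)
  show ?case
  proof (cases "w = []")
    case True
    then show ?thesis using related i by (intro exI[of _ "[]"]) (simp add: word_field_single)
  next
    case False
    then have w: "w \<in> words k" using snoc.prems by (simp add: words_def)
    obtain L where L: "\<And>p n. p \<in> set L \<Longrightarrow> Ck_on n S (fst p)"
        "\<And>p. p \<in> set L \<Longrightarrow> snd p \<in> words k"
        "\<And>p. p \<in> set L \<Longrightarrow> prec k (count_list (snd p)) (count_list w)"
      and expand: "\<And>y. y \<in> S \<Longrightarrow> frechet_derivative F (at y) (word_field X' w y) =
        (\<Prod>i\<leftarrow>w. f i y) *\<^sub>R word_field X w (F y) +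
        (\<Sum>p\<leftarrow>L. fst p y *\<^sub>R word_field X (snd p) (F y))"
      using snoc.IH[OF w] by blast
    let ?P = "\<lambda>y. \<Prod>i\<leftarrow>w. f i y" and ?Y = "word_field X' w" and ?Z = "X' i"
    define L1 where "L1 = (?P, w) # L"
    have "set w \<subseteq> {1..k}" using w by (simp add: words_def)
    then have P: "Ck_on n S ?P" for n
      by (induction w) (auto intro!: Ck_on_mult Ck_on_const S f simp del: Ck_on.simps)
    have L1: "Ck_on n S (fst p)" "snd p \<in> words k"
        "snd p = w \<or> prec k (count_list (snd p)) (count_list w)" if "p \<in> set L1" for p n
      using that L[of p] P w by (auto simp: L1_def simp del: Ck_on.simps)
    \<comment> \<open>The three parts come from bracketing a lower word with the last letter, from differentiating
       the coefficient of a word, and from differentiating \<open>f i\<close>. In the first part the leading term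
       is left out, since it yields the new leading term.\<close>
    define L' where "L' = map (\<lambda>p. (\<lambda>y. f i y * fst p y, snd p @ [i])) L @
      map (\<lambda>p. (\<lambda>y. - frechet_derivative (fst p) (at y) (?Z y), snd p)) L1 @
      [(\<lambda>y. frechet_derivative (f i) (at y) (?Y y), [i])]"
    have "frechet_derivative F (at y) (word_field X' (w @ [i]) y) =
      (\<Prod>i\<leftarrow>w @ [i]. f i y) *\<^sub>R word_field X (w @ [i]) (F y) +
      (\<Sum>p\<leftarrow>L'. fst p y *\<^sub>R word_field X (snd p) (F y))" if y: "y \<in> S" for y
    proof -
      have Fy: "F y \<in> S" using F_into y by auto
      have "frechet_derivative F (at y) (lie_bracket ?Y ?Z y) =
        (\<Sum>p\<leftarrow>L1. (f i y * fst p y) *\<^sub>R lie_bracket (word_field X (snd p)) (X i) (F y)) +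
        (\<Sum>p\<leftarrow>L1. (- frechet_derivative (fst p) (at y) (?Z y)) *\<^sub>R word_field X (snd p) (F y)) +
        frechet_derivative (f i) (at y) (?Y y) *\<^sub>R X i (F y)"
      proof (rule pushforward_bracket_combination[OF S F y])
        show "?Y differentiable (at y)" "?Z differentiable (at y)" "f i differentiable (at y)"
          "X i differentiable (at (F y))"
          using Ck_on_differentiable[OF Ck_on_word_X'[OF w] y] Ck_on_differentiable[OF X'[OF i] y]
            Ck_on_differentiable[OF f[OF i] y] Ck_on_differentiable[OF X[OF i] Fy] by blast+
        show "frechet_derivative F (at z) (?Z z) = f i z *\<^sub>R X i (F z)" if "z \<in> S" for z
          by (rule related[OF i that])
        show "frechet_derivative F (at z) (?Y z) = (\<Sum>p\<leftarrow>L1. fst p z *\<^sub>R word_field X (snd p) (F z))"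
          if "z \<in> S" for z
          using expand[OF that] by (simp add: L1_def)
        show "fst p differentiable (at y) \<and> word_field X (snd p) differentiable (at (F y))"
          if "p \<in> set L1" for p
          using Ck_on_differentiable[OF L1(1)[OF that] y]
            Ck_on_differentiable[OF Ck_on_word_X[OF L1(2)[OF that]] Fy] by blast
      qed
      moreover have "snd p \<noteq> []" if "p \<in> set L1" for p
        using L1(2)[OF that] by (simp add: words_def)
      then have "(\<Sum>p\<leftarrow>L1. (f i y * fst p y) *\<^sub>R lie_bracket (word_field X (snd p)) (X i) (F y)) =
          (\<Sum>p\<leftarrow>L1. (f i y * fst p y) *\<^sub>R word_field X (snd p @ [i]) (F y))"
        by (intro arg_cong[of _ _ sum_list] map_cong) (auto simp: word_field_snoc)
      ultimately show ?thesis
        using False by (simp add: L'_def L1_def word_field_snoc word_field_single o_def mult.commute add.assoc)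
    qed
    moreover have "(\<forall>n. Ck_on n S (fst p)) \<and> snd p \<in> words k \<and>
      prec k (count_list (snd p)) (count_list (w @ [i]))" if p: "p \<in> set L'" for p
    proof -
      consider q where "q \<in> set L" "p = (\<lambda>y. f i y * fst q y, snd q @ [i])"
        | q where "q \<in> set L1" "p = (\<lambda>y. - frechet_derivative (fst q) (at y) (?Z y), snd q)"
        | "p = (\<lambda>y. frechet_derivative (f i) (at y) (?Y y), [i])"
        using p unfolding L'_def set_append set_map list.set by blast
      then show ?thesis
      proof cases
        case 1
        then show ?thesis
          using L(2,3)[OF 1(1)] i prec_snoc[of k "snd q" w i]
          by (auto intro!: Ck_on_mult S f L(1) simp: words_def simp del: Ck_on.simps)
      next
        case 2
        then show ?thesis
          using L1[OF 2(1)] prec_append_letter[OF i L1(3)[OF 2(1)]] X'[OF i]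
          by (auto intro!: Ck_on_minus Ck_on_directional_derivative S simp del: Ck_on.simps)
      next
        case 3
        then show ?thesis
          using prec_single[OF w i] i Ck_on_word_X'[OF w] f[OF i]
          by (auto intro!: Ck_on_directional_derivative S simp: words_def simp del: Ck_on.simps)
      qed
    qed
    ultimately show ?thesis by (intro exI[of _ L']) blast
  qed
qed (simp add: words_def)


text \<open>After expansion, each determinant that contains a lower word belongs to a tuple of words of degree
  below \<open>deg I\<close>. Minimality is used at \<open>F y\<close>, where the fields \<open>X\<close> are evaluated.\<close>

lemma det_pushforward_word_fields:
  assumes I: "\<And>a. I a \<in> words k"
    and minimal: "\<And>I' y. (\<And>a. I' a \<in> words k) \<Longrightarrow> prec k (deg I') (deg I) \<Longrightarrow> y \<in> S \<Longrightarrow>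
      lambda X I' y = 0"
    and y: "y \<in> S"
  shows "det (jacobian F (at y)) * lambda X' I y =
    (\<Prod>j=1..k. f j y ^ deg I j) * lambda X I (F y)"
proof -
  define u where "u a = jacobian F (at y) *v word_field X' (I a) y" for a
  define t where "t a = (\<Prod>i\<leftarrow>I a. f i y) *\<^sub>R word_field X (I a) (F y)" for a
  define V where "V a = {word_field X v (F y) | v. v \<in> words k \<and>
    (\<forall>j\<in>{1..k}. count_list v j \<le> count_list (I a) j)}" for a
  define W where "W a = {word_field X v (F y) | v. v \<in> words k \<and>
    prec k (count_list v) (count_list (I a))}" for a
  have Fy: "F y \<in> S" using F_into y by auto
  have sub: "W a \<subseteq> V a" for a unfolding V_def W_def prec_def by blast
  have "word_field X (I a) (F y) \<in> V a" for a unfolding V_def using I by blast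
  then have t: "t a \<in> span (V a)" for a unfolding t_def by (intro span_scale span_base)
  have l: "u a - t a \<in> span (W a)" for a
  proof -
    obtain L where L: "\<And>p. p \<in> set L \<Longrightarrow> word_field X (snd p) (F y) \<in> W a"
      and "frechet_derivative F (at y) (word_field X' (I a) y) = t a +
        (\<Sum>p\<leftarrow>L. fst p y *\<^sub>R word_field X (snd p) (F y))"
      using pushforward_word_field[OF I[of a]] y unfolding W_def t_def by blast
    then have "u a - t a = (\<Sum>p\<leftarrow>L. fst p y *\<^sub>R word_field X (snd p) (F y))"
      unfolding u_def jacobian_mult_vec[OF F_differentiable[OF y]] by simp
    also have "\<dots> \<in> span (W a)"
      using L by (induction L) (auto intro!: span_add span_scale span_zero intro: span_base)
    finally show ?thesis .
  qed
  have zero: "det (\<chi> a. s a) = 0" if s: "\<And>a. s a \<in> V a" "s b \<in> W b" for b s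
  proof -
    \<comment> \<open>The row \<open>b\<close> may also be a value of a word that is not lower, so for \<open>b\<close> the word is chosen
       through \<open>W b\<close>.\<close>
    have "\<exists>v. s a = word_field X v (F y) \<and> v \<in> words k \<and>
        (\<forall>j\<in>{1..k}. count_list v j \<le> count_list (I a) j) \<and>
        (a = b \<longrightarrow> prec k (count_list v) (count_list (I a)))" for a
    proof (cases "a = b")
      case True
      then show ?thesis using s(2) unfolding W_def prec_def by blast
    next
      case False
      then show ?thesis using s(1)[of a] unfolding V_def by blast
    qed
    then obtain I' where I': "\<And>a. s a = word_field X (I' a) (F y)" "\<And>a. I' a \<in> words k"
      "\<And>a j. j \<in> {1..k} \<Longrightarrow> count_list (I' a) j \<le> count_list (I a) j"
      "prec k (count_list (I' b)) (count_list (I b))"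
      by metis
    have "lambda X I' (F y) = 0"
      by (rule minimal[OF I'(2) _ Fy], rule prec_deg[where b = b]) (use I'(3,4) in auto)
    then show ?thesis by (simp add: lambda_rows I'(1))
  qed
  have "det (jacobian F (at y)) * lambda X' I y = det (\<chi> a. t a + (u a - t a))"
    by (simp add: lambda_rows det_image_rows[symmetric] u_def)
  also have "\<dots> = det (\<chi> a. t a)"
    by (rule det_add_negligible[OF zero sub t l])
  also have "\<dots> = (\<Prod>a\<in>UNIV. \<Prod>i\<leftarrow>I a. f i y) * lambda X I (F y)"
    unfolding t_def lambda_rows scalar_mult_eq_scaleR[symmetric] by (rule det_rows_mul)
  also have "(\<Prod>a\<in>UNIV. \<Prod>i\<leftarrow>I a. f i y) = (\<Prod>j=1..k. f j y ^ deg I j)"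
  proof -
    have "(\<Prod>a\<in>UNIV. \<Prod>i\<leftarrow>I a. f i y) = (\<Prod>a\<in>UNIV. \<Prod>j=1..k. f j y ^ count_list (I a) j)"
      using I by (intro prod.cong prod_list_letters) (auto simp: words_def)
    also have "\<dots> = (\<Prod>j=1..k. \<Prod>a\<in>UNIV. f j y ^ count_list (I a) j)"
      by (rule prod.swap)
    finally show ?thesis by (simp add: deg_def power_sum)
  qed
  finally show ?thesis .
qed

text \<open>Fields annihilated by \<open>DF\<close> on an open set are closed under brackets.\<close>

lemma word_field_in_kernel:
  assumes N: "open N" "N \<subseteq> S"
    and ker: "\<And>j z. j \<in> {1..k} \<Longrightarrow> z \<in> N \<Longrightarrow> frechet_derivative F (at z) (X' j z) = 0"
  shows "w \<in> words k \<Longrightarrow> z \<in> N \<Longrightarrow> frechet_derivative F (at z) (word_field X' w z) = 0"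
proof (induction w arbitrary: z rule: rev_induct)
  case (snoc i w)
  then have i: "i \<in> {1..k}" by (simp add: words_def)
  show ?case
  proof (cases "w = []")
    case False
    then have w: "w \<in> words k" using snoc.prems by (simp add: words_def)
    have zero: "frechet_derivative (\<lambda>y. frechet_derivative F (at y) (Y y)) (at z) = (\<lambda>v. 0)"
      if "\<And>y. y \<in> N \<Longrightarrow> frechet_derivative F (at y) (Y y) = 0" for Y
      using frechet_derivative_cong_open[OF N(1) snoc.prems(2) that] by simp
    have "z \<in> S" using snoc.prems(2) N(2) by blast
    then have "word_field X' w differentiable (at z)" "X' i differentiable (at z)"
      using Ck_on_differentiable[OF Ck_on_word_X'[OF w]] Ck_on_differentiable[OF X'[OF i]] by blast+
    from pushforward_lie_bracket[OF S F \<open>z \<in> S\<close> this]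
    show ?thesis
      using False by (simp add: word_field_snoc zero[OF snoc.IH[OF w]] zero[OF ker[OF i]])
  qed (use ker i snoc.prems in \<open>simp add: word_field_single\<close>)
qed (simp add: words_def)

text \<open>Each term of a bracket contains the value of one of the two fields as a factor.\<close>

lemma word_field_vanishes:
  assumes z: "z \<in> S" and zero: "\<And>j. j \<in> {1..k} \<Longrightarrow> X' j z = 0"
  shows "w \<in> words k \<Longrightarrow> word_field X' w z = 0"
proof (induction w rule: rev_induct)
  case (snoc i w)
  then have i: "i \<in> {1..k}" by (simp add: words_def)
  show ?case
  proof (cases "w = []")
    case False
    then have w: "w \<in> words k" using snoc.prems by (simp add: words_def)
    have "linear (frechet_derivative (word_field X' w) (at z))" "linear (frechet_derivative (X' i) (at z))"
      using Ck_on_differentiable[OF Ck_on_word_X'[OF w] z] Ck_on_differentiable[OF X'[OF i] z]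
      by (intro frechet_derivative_linear; blast)+
    then show ?thesis
      using False snoc.IH[OF w] zero[OF i] by (simp add: word_field_snoc lie_bracket_def linear_0)
  qed (use zero i in \<open>simp add: word_field_single\<close>)
qed (simp add: words_def)

text \<open>If \<open>DF\<close> is singular on an open set, all word fields lie in its kernel. This kernel is a proper
  subspace unless \<open>DF = 0\<close> at \<open>z\<close>, and in that case all \<open>X' j\<close>, and with them all word fields, are
  zero at \<open>z\<close>.\<close>

lemma lambda_zero_of_degenerate:
  assumes N: "open N" "N \<subseteq> S" "z \<in> N"
    and ker: "\<And>j z. j \<in> {1..k} \<Longrightarrow> z \<in> N \<Longrightarrow> f j z = 0"
    and zero: "\<And>j. j \<in> {1..k} \<Longrightarrow> jacobian F (at z) = 0 \<Longrightarrow> X' j z = 0"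
    and I: "\<And>a. I a \<in> words k"
  shows "lambda X' I z = 0"
  unfolding lambda_rows
proof (cases "jacobian F (at z) = 0")
  case True
  then have "word_field X' (I a) z = 0" for a
    using word_field_vanishes[OF _ zero I] N by blast
  then show "det (\<chi> a. word_field X' (I a) z) = 0"
    by (intro det_zero_row(1)) (simp add: row_def vec_eq_iff)
next
  case False
  have "frechet_derivative F (at y) (X' j y) = 0" if "j \<in> {1..k}" "y \<in> N" for j y
    using related[OF that(1), of y] ker[OF that] that(2) N(2) by auto
  from word_field_in_kernel[OF N(1,2) this I N(3)]
  have "jacobian F (at z) *v word_field X' (I a) z = 0" for a
    using F_differentiable[of z] N by (auto simp: jacobian_mult_vec)
  then show "det (\<chi> a. word_field X' (I a) z) = 0"
    by (rule det_zero_kernel_rows[OF False])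
qed

lemma Ck_on_lambda:
  assumes "open T" "\<And>j n. j \<in> {1..k} \<Longrightarrow> Ck_on n T (Z j)" "\<And>a. I a \<in> words k"
  shows "Ck_on n T (lambda Z I)"
  unfolding lambda_def[abs_def]
  using Ck_on_word_field[OF assms(1,2) assms(3)]
  by (intro Ck_on_det assms(1)) (simp add: Ck_on_linear[OF assms(1) bounded_linear_vec_nth] del: Ck_on.simps)

text \<open>Dividing \<open>det_pushforward_word_fields\<close> by \<open>det DF\<close> gives the identity where \<open>F\<close> is regular. The set
  where it fails is open and consists of singular points, and there both sides vanish.\<close>

lemma lambda_pullback:
  assumes f_eq: "\<And>j y. j \<in> {1..k} \<Longrightarrow> y \<in> S \<Longrightarrow> f j y = g j y * det (jacobian F (at y))"
    and g: "\<And>j. j \<in> {1..k} \<Longrightarrow> continuous_on S (g j)"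
    and zero: "\<And>j y. j \<in> {1..k} \<Longrightarrow> y \<in> S \<Longrightarrow> jacobian F (at y) = 0 \<Longrightarrow> X' j y = 0"
    and I: "\<And>a. I a \<in> words k"
    and minimal: "\<And>I' y. (\<And>a. I' a \<in> words k) \<Longrightarrow> prec k (deg I') (deg I) \<Longrightarrow> y \<in> S \<Longrightarrow>
      lambda X I' y = 0"
    and norm: "norm1 k (deg I) \<ge> 2"
    and y: "y \<in> S"
  shows "lambda X' I y =
    (\<Prod>j=1..k. g j y ^ deg I j) * det (jacobian F (at y)) ^ (norm1 k (deg I) - 1) * lambda X I (F y)"
proof (rule ccontr)
  let ?\<delta> = "\<lambda>y. det (jacobian F (at y))"
  define R where "R y = (\<Prod>j=1..k. g j y ^ deg I j) * ?\<delta> y ^ (norm1 k (deg I) - 1) * lambda X I (F y)" for y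
  assume "lambda X' I y \<noteq> (\<Prod>j=1..k. g j y ^ deg I j) * ?\<delta> y ^ (norm1 k (deg I) - 1) * lambda X I (F y)"
  then have neq: "lambda X' I y \<noteq> R y" by (simp add: R_def)
  \<comment> \<open>One factor \<open>det DF\<close> cancels, which is why the exponent is \<open>norm1 k (deg I) - 1\<close>.\<close>
  have regular: "lambda X' I z = R z" if z: "z \<in> S" "?\<delta> z \<noteq> 0" for z
  proof -
    have "?\<delta> z * lambda X' I z = (\<Prod>j=1..k. f j z ^ deg I j) * lambda X I (F z)"
      by (rule det_pushforward_word_fields[OF I minimal z(1)])
    also have "(\<Prod>j=1..k. f j z ^ deg I j) = (\<Prod>j=1..k. g j z ^ deg I j) * ?\<delta> z ^ norm1 k (deg I)"
      using f_eq z(1) by (simp add: power_mult_distrib prod.distrib norm1_def power_sum)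
    also have "?\<delta> z ^ norm1 k (deg I) = ?\<delta> z * ?\<delta> z ^ (norm1 k (deg I) - 1)"
      using norm by (subst power_Suc[symmetric]) simp
    finally have "?\<delta> z * lambda X' I z = ?\<delta> z * R z" by (simp only: R_def mult.assoc mult.left_commute)
    then show ?thesis using z(2) by (simp only: mult_cancel_left) simp
  qed
  have "Ck_on 0 S (lambda X' I)" "Ck_on 0 S (\<lambda>y. lambda X I (F y))" "Ck_on 0 S ?\<delta>"
    by (rule Ck_on_lambda[OF S X' I], assumption)
      (rule Ck_on_compose[OF S F_into F Ck_on_lambda[OF S X I]], assumption,
        rule Ck_on_det[OF S Ck_on_jacobian_nth[OF S F]])
  then have cont: "continuous_on S (\<lambda>y. lambda X' I y - R y)"
    unfolding R_def using g by (intro continuous_intros) auto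
  let ?N = "{z \<in> S. lambda X' I z - R z \<noteq> 0}"
  have "?N = S \<inter> (\<lambda>y. lambda X' I y - R y) -` (- {0})" by auto
  then have "open ?N"
    using continuous_open_preimage[OF cont S] by (simp only:) (simp add: open_Compl)
  moreover have \<delta>0: "?\<delta> z = 0" if "z \<in> ?N" for z
    using regular[of z] that by auto
  ultimately have "lambda X' I y = 0"
    using neq y f_eq by (intro lambda_zero_of_degenerate[of ?N] zero I) auto
  moreover have "R y = 0"
    using \<delta>0[of y] neq y norm by (simp add: R_def)
  ultimately show False using neq by simp
qed

end

section \<open>Submersions\<close>

text \<open>On the open set the extension agrees with \<open>p\<close>, and so do its derivatives.\<close>

lemma smooth_submersion_on_closure_imp:
  assumes "open U" "smooth_submersion_on (closure U) p"
  shows "Ck_on n U p" and "x \<in> U \<Longrightarrow> surj (frechet_derivative p (at x))"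
proof -
  obtain g W where W: "closure U \<subseteq> W" "\<And>n. Ck_on n W g"
    and g: "\<And>x. x \<in> closure U \<Longrightarrow> g x = p x"
      "\<And>x. x \<in> closure U \<Longrightarrow> surj (frechet_derivative g (at x))"
    using assms(2) unfolding smooth_submersion_on_def smooth_extension_def by metis
  have eq: "g x = p x" and surj: "surj (frechet_derivative g (at x))" if "x \<in> U" for x
    using g[OF subsetD[OF closure_subset that]] by auto
  show "Ck_on n U p"
    by (rule Ck_on_cong_open[OF assms(1) eq
          Ck_on_subset[OF W(2) subset_trans[OF closure_subset W(1)]]])
  show "surj (frechet_derivative p (at x))" if "x \<in> U"
    using surj[OF that] frechet_derivative_cong_open[OF assms(1) that eq] by simp
qed

text \<open>Submersions are open. Smoothness of \<open>G\<^sub>j\<close> on \<open>\<pi>\<^sub>j(U)\<close> controls the Jacobian of \<open>G\<^sub>j\<close> itself,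
  rather than that of an extension, because this image is open.\<close>

lemma open_image_submersion:
  fixes p :: "'a::euclidean_space \<Rightarrow> 'b::euclidean_space"
  assumes U: "open U" and p: "Ck_on (Suc 0) U p"
    and surj: "\<And>x. x \<in> U \<Longrightarrow> surj (frechet_derivative p (at x))"
  shows "open (p ` U)"
proof -
  have "p x \<in> interior (p ` U)" if x: "x \<in> U" for x
  proof -
    have d: "(p has_derivative frechet_derivative p (at x)) (at x)"
      using Ck_on_has_derivative[OF p x] .
    obtain g' where g': "linear g'" "frechet_derivative p (at x) \<circ> g' = id"
      using linear_surjective_right_inverse[OF has_derivative_linear[OF d] surj[OF x]] by blast
    show ?thesis
      using sussmann_open_mapping[OF U _ x d linear_conv_bounded_linear[THEN iffD1, OF g'(1)] g'(2)
          subset_refl, unfolded interior_open[OF U]] Ck_on_SucD[OF p] x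
      by simp
  qed
  then have "p ` U \<subseteq> interior (p ` U)" by blast
  then show ?thesis by (metis interior_subset open_interior subset_antisym)
qed

section \<open>Exponents\<close>

text \<open>The norm of the degree is the total length of the words, and words are nonempty.\<close>

lemma norm1_deg_ge:
  fixes I :: "'d::finite \<Rightarrow> nat list"
  assumes "\<And>a. I a \<in> words k"
  shows "CARD('d) \<le> norm1 k (deg I)"
proof -
  have "norm1 k (deg I) = (\<Sum>a\<in>UNIV. \<Sum>j=1..k. count_list (I a) j)"
    unfolding norm1_def deg_def by (rule sum.swap)
  moreover have "1 \<le> (\<Sum>j=1..k. count_list (I a) j)" for a
  proof -
    have I: "I a \<noteq> []" "set (I a) \<subseteq> {1..k}" using assms[of a] by (auto simp: words_def)
    have "(\<Sum>j=1..k. count_list (I a) j) = length (I a)"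
      using sum_count_set[OF I(2)] by simp
    then show ?thesis using I(1) by (cases "I a") auto
  qed
  ultimately show ?thesis
    using sum_mono[of UNIV "\<lambda>_. 1" "\<lambda>a. \<Sum>j=1..k. count_list (I a) j"] by simp
qed

text \<open>The case distinctions are due to the conventions at zero: \<open>A j\<close> may vanish while \<open>b j = 0\<close>, and then
  both sides have the factor 1.\<close>

lemma rpow_monomial:
  fixes A :: "nat \<Rightarrow> real"
  assumes m: "norm1 k b \<ge> 2" and nonneg: "\<And>j. A j \<ge> 0" "D \<ge> 0" "L \<ge> 0"
  shows "rpow ((\<Prod>j=1..k. A j ^ b j) * D ^ (norm1 k b - 1) * L) (1 / (real (norm1 k b) - 1)) =
    (\<Prod>j=1..k. rpow (A j) (qexp k b j)) * D * rpow L (1 / (real (norm1 k b) - 1))"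
proof -
  define s where "s = 1 / (real (norm1 k b) - 1)"
  have s: "s > 0" using m by (simp add: s_def)
  have A: "(A j ^ b j) powr s = rpow (A j) (qexp k b j)" for j
  proof (cases "b j = 0")
    case True
    then show ?thesis by (simp add: rpow_def qexp_def)
  next
    case False
    have q: "qexp k b j = real (b j) * s" by (simp add: qexp_def s_def)
    show ?thesis
    proof (cases "A j = 0")
      case True
      then show ?thesis using False s by (simp add: rpow_def q)
    next
      case A0: False
      then show ?thesis
        using False s nonneg(1)[of j] by (simp add: rpow_def q powr_realpow[symmetric] powr_powr)
    qed
  qed
  have D: "(D ^ (norm1 k b - 1)) powr s = D"
  proof (cases "D = 0")
    case True
    then show ?thesis using m by simp
  next
    case False
    then have "(D ^ (norm1 k b - 1)) powr s = D powr (real (norm1 k b - 1) * s)"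
      using nonneg(2) by (simp add: powr_realpow[symmetric] powr_powr)
    also have "real (norm1 k b - 1) * s = 1" using m by (simp add: s_def of_nat_diff)
    finally show ?thesis using False nonneg(2) by simp
  qed
  have "((\<Prod>j=1..k. A j ^ b j) * D ^ (norm1 k b - 1) * L) powr s =
      (\<Prod>j=1..k. (A j ^ b j) powr s) * (D ^ (norm1 k b - 1)) powr s * L powr s"
    using nonneg by (simp add: powr_mult prod_powr_distrib prod_nonneg)
  then show ?thesis
    unfolding s_def[symmetric] rpow_def[of _ s] using s by (simp add: A D del: One_nat_def)
qed

section \<open>The transformation law of rho\<close>

theorem proposition3p1:
  fixes U :: "(real ^ 'd::{finite,linorder}) set"
    and k :: nat
    and \<pi> :: "nat \<Rightarrow> real ^ 'd::{finite,linorder} \<Rightarrow> real ^ 'e::{finite,linorder}"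
    and I0 :: "'d \<Rightarrow> nat list"
    and F :: "real ^ 'd::{finite,linorder} \<Rightarrow> real ^ 'd::{finite,linorder}"
    and G :: "nat \<Rightarrow> real ^ 'e::{finite,linorder} \<Rightarrow> real ^ 'e::{finite,linorder}"
    and X X' :: "nat \<Rightarrow> real ^ 'd::{finite,linorder} \<Rightarrow> real ^ 'd::{finite,linorder}"
  assumes dim: "CARD('d) = CARD('e) + 1" "CARD('d) \<ge> 2"
    and k: "k \<ge> 2"
    and U: "open U"
    and submersion: "\<And>j. j \<in> {1..k} \<Longrightarrow> smooth_submersion_on (closure U) (\<pi> j)"
    and X: "\<And>j. X j = star_field (\<pi> j)"
    and I0: "\<And>a. I0 a \<in> words k"
    and minimal: "\<And>I' x. (\<And>a. I' a \<in> words k) \<Longrightarrow> prec k (deg I') (deg I0) \<Longrightarrow>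
                    x \<in> U \<Longrightarrow> lambda X I' x = 0"
    and F: "smooth_on U F" "F ` U \<subseteq> U"
    and G: "\<And>j. j \<in> {1..k} \<Longrightarrow> smooth_on (\<pi> j ` U) (G j)"
    and X': "\<And>j. X' j = star_field (G j \<circ> \<pi> j \<circ> F)"
  shows "\<forall>x\<in>U. rho k X' I0 x =
           (\<Prod>j=1..k. rpow \<bar>det (jacobian (G j) (at (\<pi> j (F x))))\<bar> (qexp k (deg I0) j))
             * \<bar>det (jacobian F (at x))\<bar> * rho k X I0 (F x)"
proof
  fix x assume x: "x \<in> U"
  define g where "g j y = det (jacobian (G j) (at (\<pi> j (F y))))" for j y
  define f where "f j y = g j y * det (jacobian F (at y))" for j y
  have CF: "Ck_on n U F" for n using F(1) by (simp add: smooth_on_open_iff[OF U])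
  have C\<pi>: "Ck_on n U (\<pi> j)" if "j \<in> {1..k}" for j n
    by (rule smooth_submersion_on_closure_imp(1)[OF U submersion[OF that]])
  have V: "open (\<pi> j ` U)" if "j \<in> {1..k}" for j
    by (rule open_image_submersion[OF U C\<pi>[OF that]
          smooth_submersion_on_closure_imp(2)[OF U submersion[OF that]]])
  have CG: "Ck_on n (\<pi> j ` U) (G j)" if "j \<in> {1..k}" for j n
    using G[OF that] by (simp add: smooth_on_open_iff[OF V[OF that]])
  have C\<pi>F: "Ck_on n U (\<lambda>y. \<pi> j (F y))" if "j \<in> {1..k}" for j n
    by (rule Ck_on_compose[OF U F(2) CF C\<pi>[OF that]])
  have \<pi>F: "(\<lambda>y. \<pi> j (F y)) ` U \<subseteq> \<pi> j ` U" for j using F(2) by blast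
  have Cg: "Ck_on n U (g j)" if "j \<in> {1..k}" for j n
    unfolding g_def
    by (rule Ck_on_compose[OF U \<pi>F C\<pi>F[OF that] Ck_on_det[OF V[OF that]
            Ck_on_jacobian_nth[OF V[OF that] CG[OF that]]]])
  have C\<delta>: "Ck_on n U (\<lambda>y. det (jacobian F (at y)))" for n
    by (rule Ck_on_det[OF U Ck_on_jacobian_nth[OF U CF]])
  have C\<pi>': "Ck_on n U (G j \<circ> \<pi> j \<circ> F)" if "j \<in> {1..k}" for j n
    unfolding o_def by (rule Ck_on_compose[OF U \<pi>F C\<pi>F[OF that] CG[OF that]])
  have X'_eq: "X' j y = star_vec ((jacobian (G j) (at (\<pi> j (F y))) ** jacobian (\<pi> j) (at (F y)))
      ** jacobian F (at y))" if j: "j \<in> {1..k}" and y: "y \<in> U" for j y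
  proof -
    have Fy: "F y \<in> U" using F(2) y by blast
    have d: "F differentiable (at y)" "\<pi> j differentiable (at (F y))"
      "(\<lambda>z. \<pi> j (F z)) differentiable (at y)" "G j differentiable (at (\<pi> j (F y)))"
      using Ck_on_differentiable[OF CF y] Ck_on_differentiable[OF C\<pi>[OF j] Fy]
        Ck_on_differentiable[OF C\<pi>F[OF j] y] Ck_on_differentiable[OF CG[OF j], of "\<pi> j (F y)"] Fy by auto
    have "jacobian (G j \<circ> (\<pi> j \<circ> F)) (at y) =
        jacobian (G j) (at (\<pi> j (F y))) ** (jacobian (\<pi> j) (at (F y)) ** jacobian F (at y))"
      using jacobian_compose[of "\<pi> j \<circ> F" y "G j"] jacobian_compose[OF d(1,2)] d
      by (simp add: o_def)
    then show ?thesis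
      unfolding X' using star_field_eq_star_vec[OF Ck_on_differentiable[OF C\<pi>'[OF j] y]]
      by (simp add: o_assoc matrix_mul_assoc)
  qed
  interpret related_fields k U F X X' f
  proof
    fix j n assume j: "j \<in> {1..k}"
    show "Ck_on n U (X j)" unfolding X by (rule Ck_on_star_field[OF U C\<pi>[OF j]])
    show "Ck_on n U (X' j)" unfolding X' by (rule Ck_on_star_field[OF U C\<pi>'[OF j]])
    show "Ck_on n U (f j)" unfolding f_def by (rule Ck_on_mult[OF U Cg[OF j] C\<delta>])
  next
    fix j y assume j: "j \<in> {1..k}" and y: "y \<in> U"
    have Fy: "F y \<in> U" using F(2) y by blast
    have "frechet_derivative F (at y) (X' j y) = jacobian F (at y) *v X' j y"
      by (rule jacobian_mult_vec[symmetric, OF Ck_on_differentiable[OF CF y]])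
    also have "\<dots> = f j y *\<^sub>R X j (F y)"
      unfolding X'_eq[OF j y] star_vec_pullback[OF dim(1)] star_vec_mult_left X
        star_field_eq_star_vec[OF Ck_on_differentiable[OF C\<pi>[OF j] Fy]]
      by (simp add: f_def g_def mult.commute)
    finally show "frechet_derivative F (at y) (X' j y) = f j y *\<^sub>R X j (F y)" .
  qed (use U CF F(2) in \<open>auto simp del: Ck_on.simps\<close>)
  have norm: "norm1 k (deg I0) \<ge> 2"
    by (rule order_trans[OF dim(2) norm1_deg_ge]) (rule I0)
  have "lambda X' I0 x = (\<Prod>j=1..k. g j x ^ deg I0 j) *
      det (jacobian F (at x)) ^ (norm1 k (deg I0) - 1) * lambda X I0 (F x)"
  proof (rule lambda_pullback[OF _ _ _ I0 minimal norm x])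
    show "f j y = g j y * det (jacobian F (at y))" for j y by (simp add: f_def)
    show "continuous_on U (g j)" if "j \<in> {1..k}" for j using Cg[OF that, of 0] by simp
    show "X' j y = 0" if "j \<in> {1..k}" "y \<in> U" "jacobian F (at y) = 0" for j y
    proof -
      have "M ** (0 :: real ^ 'd::{finite,linorder} ^ 'd::{finite,linorder}) = 0"
        for M :: "real ^ 'd::{finite,linorder} ^ 'e::{finite,linorder}"
        by (simp add: matrix_matrix_mult_def vec_eq_iff)
      then show ?thesis unfolding X'_eq[OF that(1,2)] that(3) by (simp add: star_vec_zero)
    qed
  qed
  then show "rho k X' I0 x =
      (\<Prod>j=1..k. rpow \<bar>det (jacobian (G j) (at (\<pi> j (F x))))\<bar> (qexp k (deg I0) j))
        * \<bar>det (jacobian F (at x))\<bar> * rho k X I0 (F x)"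
    unfolding rho_def
    using rpow_monomial[OF norm, of "\<lambda>j. \<bar>g j x\<bar>" "\<bar>det (jacobian F (at x))\<bar>" "\<bar>lambda X I0 (F x)\<bar>"]
    by (simp add: abs_mult abs_prod power_abs g_def)
qed

end
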